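(* Let $n\ge 2$. Every $n$-diagram is equivalent to an $n$-diagram generated from the unit $n$-diagram $I$, the circular $n$-diagram $C$ and the diapsidal $n$-diagrams $H^i$, for $1\le i\le n-1$, with the operation of composition $\circ$.
   Context: $n$-diagrams. For real $a>0$ let $R_{n,a}=[0,n+1]\times[0,a]$, with top $[0,n+1]\times\{a\}$ and bottom $[0,n+1]\times\{0\}$. An $n$-diagram $D$ in $R_{n,a}$ (for some real $a>0$) is a compact one-manifold with boundary, with finitely many connected components, embedded in $R_{n,a}$, such that its intersection with the top is $t(D)=\{(i,a): i=1,\dots,n\}$, its intersection with the bottom is $b(D)=\{(i,0): i=1,\dots,n\}$, and $t(D)\cup b(D)$ is its set of boundary points. Its components homeomorphic to $[0,1]$ are called threads; its components homeomorphic to the circle $S^1$ are called circular components. A thread is transversal if it has one end point in $t(D)$ and one in $b(D)$; otherwise it is a cup if both end points are in $t(D)$, and a cap if both are in $b(D)$. Equivalence. $n$-diagrams $D_1$ in $R_{n,a}$ and $D_2$ in $R_{n,b}$ are equivalent, $D_1\simeq D_2$, iff there is a homeomorphism $g:D_1\to D_2$ with $g(i,0)=(i,0)$ and $g(i,a)=(i,b)$ for $i=1,\dots,n$. Composition. For $D_1$ in $R_{n,a}$ and $D_2$ in $R_{n,b}$, $D_2\circ D_1=\{(x,y+b):(x,y)\in D_1\}\cup D_2$, an $n$-diagram in $R_{n,a+b}$. Particular diagrams. The unit $n$-diagram is $I=\{(i,y): i\in\{1,\dots,n\},\ y\in[0,1]\}$ in $R_{n,1}$. The circular $n$-diagram $C$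 is $I$ together with one circular component, the circle of radius $1/4$ with centre $(1/2,1/2)$. With $a(n)=\max\{5,(n-1)(n-2)/2\}$, the diapsidal $n$-diagram $H^i$ ($1\le i\le n-1$) in $R_{n,a(n)}$ has no circular components, has a single cup, a semicircle with end points $(i,a(n))$ and $(i+1,a(n))$, a single cap, a semicircle with end points $(i,0)$ and $(i+1,0)$, and all its other threads are vertical straight line segments $\{j\}\times[0,a(n)]$ for $j\in\{1,\dots,n\}\setminus\{i,i+1\}$. *)

theory Defs
  imports "HOL-Analysis.Analysis"
begin

section \<open>Topological one-manifolds with boundary\<close>

text \<open>
  The Hausdorff and second countability axioms are supplied by the type classes, since both
  properties are inherited by subspaces.
\<close>

definition half_line_chart ::
  "'a::{t2_space, second_countable_topology} set \<Rightarrow> 'a set \<Rightarrow> ('a \<Rightarrow> real) \<Rightarrow> bool" where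
  "half_line_chart M U f \<longleftrightarrow>
     openin (top_of_set M) U \<and>
     (\<exists>V g. openin (top_of_set {0..}) V \<and> homeomorphism U V f g)"

definition one_manifold_with_boundary ::
  "'a::{t2_space, second_countable_topology} set \<Rightarrow> bool" where
  "one_manifold_with_boundary M \<longleftrightarrow> (\<forall>p\<in>M. \<exists>U f. p \<in> U \<and> half_line_chart M U f)"

definition manifold_boundary ::
  "'a::{t2_space, second_countable_topology} set \<Rightarrow> 'a set" where
  "manifold_boundary M = {p \<in> M. \<exists>U f. p \<in> U \<and> half_line_chart M U f \<and> f p = 0}"


section \<open>Diagrams, equivalence and composition\<close>

text \<open>
  A diagram is a subset of the plane, and the height \<open>a\<close> of the ambient rectangle is carried
  along as a separate argument.
\<close>

definition rect :: "nat \<Rightarrow> real \<Rightarrow> (real \<times> real) set" where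
  "rect n a = {0..real n + 1} \<times> {0..a}"

definition marked_points :: "nat \<Rightarrow> real \<Rightarrow> (real \<times> real) set" where
  "marked_points n y = {(real i, y) | i. i \<in> {1..n}}"

definition n_diagram :: "nat \<Rightarrow> real \<Rightarrow> (real \<times> real) set \<Rightarrow> bool" where
  "n_diagram n a D \<longleftrightarrow>
     a > 0 \<and>
     D \<subseteq> rect n a \<and>
     compact D \<and>
     one_manifold_with_boundary D \<and>
     finite (components D) \<and>
     D \<inter> ({0..real n + 1} \<times> {a}) = marked_points n a \<and>
     D \<inter> ({0..real n + 1} \<times> {0}) = marked_points n 0 \<and>
     manifold_boundary D = marked_points n a \<union> marked_points n 0"

definition diagram_equiv ::
  "nat \<Rightarrow> real \<Rightarrow> (real \<times> real) set \<Rightarrow> real \<Rightarrow> (real \<times> real) set \<Rightarrow> bool" where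
  "diagram_equiv n a D\<^sub>1 b D\<^sub>2 \<longleftrightarrow>
     (\<exists>g h. homeomorphism D\<^sub>1 D\<^sub>2 g h \<and>
        (\<forall>i\<in>{1..n}. g (real i, 0) = (real i, 0) \<and> g (real i, a) = (real i, b)))"

text \<open>
  \<open>diagram_comp b D\<^sub>2 D\<^sub>1\<close> is the composition \<open>D\<^sub>2 \<circ> D\<^sub>1\<close>, where \<open>b\<close> is the height of \<open>D\<^sub>2\<close>.
\<close>

definition diagram_comp ::
  "real \<Rightarrow> (real \<times> real) set \<Rightarrow> (real \<times> real) set \<Rightarrow> (real \<times> real) set" where
  "diagram_comp b D\<^sub>2 D\<^sub>1 = {(x, y + b) | x y. (x, y) \<in> D\<^sub>1} \<union> D\<^sub>2"


section \<open>The generating diagrams\<close>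

definition unit_diagram :: "nat \<Rightarrow> (real \<times> real) set" where
  "unit_diagram n = {(real i, y) | i y. i \<in> {1..n} \<and> y \<in> {0..1}}"

text \<open>The metric on \<^typ>\<open>real \<times> real\<close> is the Euclidean one, so spheres are round circles.\<close>

definition circular_diagram :: "nat \<Rightarrow> (real \<times> real) set" where
  "circular_diagram n = unit_diagram n \<union> sphere (1/2, 1/2) (1/4)"

definition diapsidal_height :: "nat \<Rightarrow> real" where
  "diapsidal_height n = max 5 ((real n - 1) * (real n - 2) / 2)"

definition diapsidal_diagram :: "nat \<Rightarrow> nat \<Rightarrow> (real \<times> real) set" where
  "diapsidal_diagram n i =
     {p \<in> sphere (real i + 1/2, diapsidal_height n) (1/2). snd p \<le> diapsidal_height n} \<union>
     {p \<in> sphere (real i + 1/2, 0) (1/2). snd p \<ge> 0} \<union>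
     {(real j, y) | j y. j \<in> {1..n} - {i, i + 1} \<and> y \<in> {0..diapsidal_height n}}"

inductive generated :: "nat \<Rightarrow> real \<Rightarrow> (real \<times> real) set \<Rightarrow> bool" for n :: nat where
  unit: "generated n 1 (unit_diagram n)"
| circular: "generated n 1 (circular_diagram n)"
| diapsidal: "1 \<le> i \<Longrightarrow> i + 1 \<le> n \<Longrightarrow> generated n (diapsidal_height n) (diapsidal_diagram n i)"
| comp: "generated n a D\<^sub>1 \<Longrightarrow> generated n b D\<^sub>2 \<Longrightarrow> generated n (a + b) (diagram_comp b D\<^sub>2 D\<^sub>1)"

end

theory Submission imports Defs begin

text \<open>
  Up to equivalence a diagram is determined by which boundary points its threads join, and by the
  number of its circular components: a homeomorphism of diagrams can be put together from
  homeomorphisms of the components (\<open>arc_system_equivalence\<close>). The theorem is thus a statement about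
  perfect matchings of \<open>2 * n\<close> points, in three parts.

  Every diagram has a matching. A component of a compact one-manifold is an arc or a simple closed
  curve, and an arc meets the boundary of the manifold in its two end points
  (\<open>component_of_compact_one_manifold\<close>). The proof enlarges arcs: any finite set of points of a
  component lies on a single arc, so there is an arc through the end points of finitely many small
  arcs that cover the component. Either it swallows all the small arcs and is the whole component,
  or a part of a small arc that leaves it closes it up to a simple closed curve, which is then the
  whole component.

  This matching has no crossings. When the \<open>2 * n\<close> points are numbered along the bottom from left
  to right and back along the top from right to left, two threads with interlaced end points would
  have to meet. This is the Fashoda meet theorem, after the rectangle has been bent into a fan
  that brings the top and the bottom to one line (\<open>disjoint_arcs_do_not_interlace\<close>).

  Every noncrossing matching, with any number of circles, is generated. Composition with \<open>H\<^sup>i\<close> at the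
  bottom changes the matching by a surgery at the points \<open>i\<close> and \<open>i + 1\<close>
  (\<open>diapsidal_comp_realizes\<close>), and composition with \<open>C\<close> adds one circle. Suppose that all strands
  beyond the \<open>m\<close>-th are vertical and that there is a cap among the first \<open>m\<close> bottom points. An
  innermost cap joins neighbours \<open>i\<close> and \<open>i + 1\<close>; surgery at \<open>i + 1\<close> moves it one place to the right,
  and surgery at \<open>i\<close> takes it back (\<open>move_cap\<close>). So the cap may be assumed to join \<open>m - 1\<close> and \<open>m\<close>.
  Then the matching is obtained by surgery at \<open>m - 1\<close> from one whose \<open>m\<close>-th strand is vertical too
  (\<open>straighten_strand\<close>). By induction on \<open>m\<close> a matching without caps is reached, and absence
  of crossings leaves only the matching of the unit diagram.
\<close>

section \<open>Arcs and closed curves\<close>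

definition arc_between :: "'a::topological_space set \<Rightarrow> 'a \<Rightarrow> 'a \<Rightarrow> bool" where
  "arc_between S x y \<longleftrightarrow> (\<exists>g. arc g \<and> path_image g = S \<and> pathstart g = x \<and> pathfinish g = y)"

definition closed_curve :: "'a::topological_space set \<Rightarrow> bool" where
  "closed_curve S \<longleftrightarrow> (\<exists>g. simple_path g \<and> pathfinish g = pathstart g \<and> path_image g = S)"

lemma arc_between_sym: "arc_between S x y \<Longrightarrow> arc_between S y x"
  unfolding arc_between_def
  by (metis arc_reversepath path_image_reversepath pathfinish_reversepath pathstart_reversepath)

lemma arc_between_ends:
  assumes "arc_between S x y" shows "x \<in> S" "y \<in> S" "x \<noteq> y"
  using assms unfolding arc_between_def
  by (auto dest: arc_distinct_ends)

lemma arc_between_topology: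
  fixes S :: "'a::t2_space set"
  assumes "arc_between S x y"
  shows "compact S" "closed S" "connected S"
proof -
  obtain g where g: "arc g" "path_image g = S"
    using assms unfolding arc_between_def by blast
  show "compact S" using compact_path_image[of g] arc_imp_path g by auto
  then show "closed S" by (rule compact_imp_closed)
  show "connected S" using connected_path_image[of g] arc_imp_path g by auto
qed

lemma arc_between_Un:
  assumes "arc_between S x y" "arc_between T y z" "S \<inter> T \<subseteq> {y}"
  shows "arc_between (S \<union> T) x z"
proof -
  obtain g h where "arc g" "path_image g = S" "pathstart g = x" "pathfinish g = y"
    and "arc h" "path_image h = T" "pathstart h = y" "pathfinish h = z"
    using assms unfolding arc_between_def by blast
  then show ?thesis
    unfolding arc_between_def using assms(3)
    by (intro exI[of _ "g +++ h"]) (auto simp: arc_join path_image_join)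
qed

lemma closed_curve_Un:
  assumes "arc_between S x y" "arc_between T y x" "S \<inter> T \<subseteq> {x, y}"
  shows "closed_curve (S \<union> T)"
proof -
  obtain g h where "arc g" "path_image g = S" "pathstart g = x" "pathfinish g = y"
    and "arc h" "path_image h = T" "pathstart h = y" "pathfinish h = x"
    using assms unfolding arc_between_def by blast
  then show ?thesis
    unfolding closed_curve_def using assms(3)
    by (intro exI[of _ "g +++ h"]) (auto simp: simple_path_join_loop path_image_join)
qed

lemma closed_curve_topology:
  fixes S :: "'a::t2_space set"
  assumes "closed_curve S"
  shows "compact S" "closed S" "connected S" "S \<noteq> {}"
proof -
  obtain g where g: "simple_path g" "path_image g = S"
    using assms unfolding closed_curve_def by blast
  then have p: "path g" by (simp add: simple_path_imp_path)
  show "compact S" using compact_path_image[OF p] g by auto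
  then show "closed S" by (rule compact_imp_closed)
  show "connected S" using connected_path_image[OF p] g by auto
  show "S \<noteq> {}" using path_image_nonempty[of g] g by auto
qed

text \<open>
  A closed curve has no end points: a parametrization can be rotated until the given point lies
  strictly inside the parameter interval, and then a subpath around it is an arc.
\<close>

lemma interior_point_of_closed_curve:
  fixes S :: "'a::real_normed_vector set"
  assumes "closed_curve S" "p \<in> S"
  obtains g t N where "arc g" "path_image g \<subseteq> S" "0 < t" "t < 1" "g t = p"
    "openin (top_of_set S) N" "p \<in> N" "N \<subseteq> path_image g"
proof -
  obtain c0 where c0: "simple_path c0" "pathfinish c0 = pathstart c0" "path_image c0 = S"
    using assms unfolding closed_curve_def by blast
  obtain c u where c: "simple_path c" "path_image c = S" "0 < u" "u < 1" "c u = p"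
  proof -
    obtain v where v: "v \<in> {0..1}" "c0 v = p"
      using assms c0 by (auto simp: path_image_def)
    show ?thesis
    proof (cases "0 < v \<and> v < 1")
      case True
      then show ?thesis using that[of c0 v] c0 v by auto
    next
      case False
      then have "c0 1 = p"
        using v c0(2) by (auto simp: pathstart_def pathfinish_def)
      \<comment> \<open>The base point moves to the middle of the parameter interval when the start moves to \<open>c0 (1/2)\<close>.\<close>
      then have "shiftpath (1/2) c0 (1/2) = p" by (simp add: shiftpath_def)
      then show ?thesis
        using that[of "shiftpath (1/2) c0" "1/2"] c0
        by (auto simp: simple_path_shiftpath path_image_shiftpath)
    qed
  qed
  have path: "path c" using c by (simp add: simple_path_imp_path)
  have inj: "x = y" if "c x = c y" "x \<in> {0<..<1}" "y \<in> {0..1}" for x y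
    using c(1) that unfolding simple_path_def loop_free_def by fastforce
  define g where "g = subpath (u/2) ((1+u)/2) c"
  define B where "B = c ` ({0..u/2} \<union> {(1+u)/2..1})"
  define N where "N = S - B"
  have "compact B" unfolding B_def
    using path c by (intro compact_continuous_image continuous_on_subset[OF path[unfolded path_def]]) auto
  then have N: "openin (top_of_set S) N"
    by (metis N_def compact_imp_closed openin_diff openin_subtopology_self closedin_closed_Int Diff_Int_distrib
        Diff_Int2 Int_commute openin_open_Int open_Compl Diff_eq)
  show thesis
  proof
    show "arc g" unfolding g_def
      using c by (intro arc_simple_path_subpath_interior) (auto simp: abs_if field_simps)
    have im: "path_image g = c ` {u/2..(1+u)/2}" unfolding g_def
      using c by (subst path_image_subpath) auto
    show "path_image g \<subseteq> S"
      using c path_image_subpath_subset[of "u/2" "(1+u)/2" c] by (simp add: g_def)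
    show "openin (top_of_set S) N" by (rule N)
    show "p \<in> N"
    proof -
      have "p \<notin> B" unfolding B_def using c inj[of u] by (auto simp: field_simps) (smt (verit) field_sum_of_halves)+
      then show ?thesis using assms by (simp add: N_def)
    qed
    show "N \<subseteq> path_image g"
    proof
      fix x assume "x \<in> N"
      then obtain s where s: "s \<in> {0..1}" "x = c s" "c s \<notin> B"
        using c(2) unfolding N_def path_image_def by blast
      then have "s \<notin> {0..u/2} \<union> {(1+u)/2..1}" unfolding B_def by blast
      then show "x \<in> path_image g" unfolding im using s by auto
    qed
    \<comment> \<open>With these end points of the subpath, the parameter \<open>u\<close> belongs to the same point on it.\<close>
    show "0 < u" "u < 1" by (rule c)+
    show "g u = p" unfolding g_def subpath_def using c by (simp add: field_simps)
  qed
qed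

section \<open>Arcs inside one-manifolds\<close>

text \<open>
  Invariance of domain in dimension one. In a chart, an injective path is a strictly monotone real
  function. So it takes all values near the one at an inner parameter, and this one exceeds a value taken
  on one of the two sides and is therefore positive. As the chart was arbitrary, the point is not a
  boundary point.
\<close>

lemma arc_interior_in_manifold:
  fixes M :: "'a::{t2_space, second_countable_topology} set"
  assumes M: "one_manifold_with_boundary M" and g: "arc g" "path_image g \<subseteq> M"
    and t: "0 < t" "t < 1"
  shows "\<exists>N. openin (top_of_set M) N \<and> g t \<in> N \<and> N \<subseteq> path_image g"
    and "g t \<notin> manifold_boundary M"
proof -
  have main: "(\<exists>N. openin (top_of_set M) N \<and> g t \<in> N \<and> N \<subseteq> path_image g) \<and> 0 < f (g t)"
    if U: "g t \<in> U" "half_line_chart M U f" for U f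
  proof -
    obtain V h where V: "openin (top_of_set M) U" "openin (top_of_set {0..}) V" "homeomorphism U V f h"
      using U(2) unfolding half_line_chart_def by blast
    have cf: "continuous_on U f" and Vpos: "f ` U \<subseteq> {0..}"
      using V homeomorphism_def[of U V f h] openin_imp_subset[OF V(2)] by auto
    have injf: "inj_on f U"
      using homeomorphism_apply1[OF V(3)] by (rule inj_on_inverseI)
    have cg: "continuous_on {0..1} g" and ig: "inj_on g {0..1}"
      using g by (auto simp: arc_def path_def)
    have "openin (top_of_set {0..1}) ({0..1} \<inter> g -` U)"
      using continuous_openin_preimage[OF cg _ V(1)] g(2) by (auto simp: path_image_def)
    then obtain d where d: "d > 0" "\<And>s. s \<in> {0..1} \<Longrightarrow> dist s t < d \<Longrightarrow> g s \<in> U"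
      using t U(1) unfolding openin_euclidean_subtopology_iff
      by (metis IntI atLeastAtMost_iff less_imp_le vimageI2 vimageD IntD2)
    define e where "e = min (d/2) (min t (1 - t))"
    have e: "e > 0" "e < d" "t - e \<ge> 0" "t + e \<le> 1" using d t by (auto simp: e_def)
    let ?I = "{t - e..t + e}"
    have I: "?I \<subseteq> {0..1}" using e by auto
    have gU: "g ` ?I \<subseteq> U" using d(2) e I by (auto simp: dist_real_def)
    have cfg: "continuous_on ?I (f \<circ> g)"
      using cf cg gU I by (meson continuous_on_compose continuous_on_subset)
    have ifg: "inj_on (f \<circ> g) ?I"
      using ig injf gU I by (meson comp_inj_on inj_on_subset)
    let ?a = "f (g (t - e))" and ?b = "f (g (t + e))"
    have bt: "?a < f (g t) \<and> f (g t) < ?b \<or> ?b < f (g t) \<and> f (g t) < ?a"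
      using continuous_inj_imp_mono[OF _ _ cfg ifg, of t] e by simp
    have "t - e \<in> ?I" "t + e \<in> ?I" using e by auto
    then have nn: "?a \<ge> 0" "?b \<ge> 0" using Vpos gU by blast+
    define N where "N = U \<inter> f -` {min ?a ?b<..<max ?a ?b}"
    have "openin (top_of_set U) N"
      unfolding N_def using cf by (intro continuous_openin_preimage_gen) auto
    then have "openin (top_of_set M) N" using V(1) openin_trans by blast
    moreover have "g t \<in> N" using bt U(1) by (auto simp: N_def)
    moreover have "N \<subseteq> path_image g"
    proof
      fix x assume x: "x \<in> N"
      have "connected ((f \<circ> g) ` ?I)" by (intro connected_continuous_image cfg) simp
      moreover have "?a \<in> (f \<circ> g) ` ?I" "?b \<in> (f \<circ> g) ` ?I" using e by auto
      ultimately have "f x \<in> (f \<circ> g) ` ?I"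
        using x unfolding N_def connected_iff_interval
        by (auto simp: min_def max_def split: if_splits)
      then obtain s where s: "s \<in> ?I" "f x = f (g s)" by auto
      then have "x = g s" using injf x gU unfolding N_def inj_on_def by blast
      then show "x \<in> path_image g" using s I by (auto simp: path_image_def)
    qed
    ultimately show ?thesis using bt nn by auto
  qed
  have "g t \<in> M" using g t by (auto simp: path_image_def)
  then obtain U f where "g t \<in> U" "half_line_chart M U f"
    using M unfolding one_manifold_with_boundary_def by blast
  then show "\<exists>N. openin (top_of_set M) N \<and> g t \<in> N \<and> N \<subseteq> path_image g"
    using main by blast
  show "g t \<notin> manifold_boundary M"
    using main unfolding manifold_boundary_def by fastforce
qed

lemma arc_neighbourhood_in_manifold:
  fixes M :: "'a::{t2_space, second_countable_topology} set"
  assumes M: "one_manifold_with_boundary M" and p: "p \<in> M"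
  obtains g N where "arc g" "path_image g \<subseteq> M" "openin (top_of_set M) N" "p \<in> N" "N \<subseteq> path_image g"
proof -
  obtain U f where U: "p \<in> U" "half_line_chart M U f"
    using M p unfolding one_manifold_with_boundary_def by blast
  then obtain V h where V: "openin (top_of_set M) U" "openin (top_of_set {0..}) V" "homeomorphism U V f h"
    unfolding half_line_chart_def by blast
  have fp: "f p \<in> V" "f p \<ge> 0" using V U homeomorphism_image1[OF V(3)] openin_imp_subset[OF V(2)] by auto
  then obtain e where e: "e > 0" "\<And>s. s \<ge> 0 \<Longrightarrow> dist s (f p) < e \<Longrightarrow> s \<in> V"
    using V(2) unfolding openin_euclidean_subtopology_iff by auto
  define c d where "c = max 0 (f p - e/2)" and "d = f p + e/2"
  have cd: "c < d" "c \<ge> 0" "{c..d} \<subseteq> V" using e fp by (auto simp: c_def d_def dist_real_def)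
  define g where "g = h \<circ> linepath c d"
  have im: "path_image (linepath c d) = {c..d}"
    using cd by (simp add: closed_segment_eq_real_ivl)
  have ch: "continuous_on V h" and ih: "inj_on h V" and hV: "h ` V = U"
    using V(3) by (auto simp: homeomorphism_def intro: inj_on_inverseI[of _ f])
  show thesis
  proof
    show "arc g"
      unfolding g_def arc_def
    proof
      show "path (h \<circ> linepath c d)"
        using ch im cd by (intro path_continuous_image) (auto intro: continuous_on_subset)
      show "inj_on (h \<circ> linepath c d) {0..1}"
        using arc_linepath[of c d] cd ih im
        by (intro comp_inj_on) (auto simp: arc_def path_image_def intro: inj_on_subset)
    qed
    have img: "path_image g = h ` {c..d}" using im by (simp add: g_def path_image_compose)
    then show "path_image g \<subseteq> M" using cd hV openin_imp_subset[OF V(1)] by blast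
    define N where "N = U \<inter> f -` ball (f p) (e/2)"
    have "openin (top_of_set U) N"
      unfolding N_def using homeomorphism_cont1[OF V(3)] by (intro continuous_openin_preimage_gen) auto
    then show "openin (top_of_set M) N" using V(1) openin_trans by blast
    show "p \<in> N" using U e by (simp add: N_def)
    show "N \<subseteq> path_image g"
    proof
      fix x assume x: "x \<in> N"
      then have fx: "f x \<in> V" "x = h (f x)"
        using homeomorphism_image1[OF V(3)] homeomorphism_apply1[OF V(3)] by (auto simp: N_def)
      then have "f x \<ge> 0" using openin_imp_subset[OF V(2)] by auto
      moreover have "\<bar>f p - f x\<bar> < e/2" using x by (simp add: N_def dist_real_def)
      ultimately have "f x \<in> {c..d}" unfolding c_def d_def by (simp only: atLeastAtMost_iff) linarith
      then show "x \<in> path_image g" unfolding img using fx by blast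
    qed
  qed
qed

text \<open>
  The inverse of a parametrization is a chart away from the final point, where \<open>[0, 1)\<close> is open in the
  half-line. At the final point the reversed path serves instead.
\<close>

lemma chart_from_arc:
  fixes M :: "'a::{t2_space, second_countable_topology} set"
  assumes g: "arc g" "path_image g \<subseteq> M" and N: "openin (top_of_set M) N" "N \<subseteq> path_image g"
    and p: "p \<in> N" "p \<noteq> pathfinish g"
  obtains U f where "p \<in> U" "half_line_chart M U f" "f p = 0 \<longleftrightarrow> p = pathstart g"
proof -
  obtain f where f: "homeomorphism {0..1} (path_image g) g f" using homeomorphism_arc[OF g(1)] by blast
  define U where "U = N - {pathfinish g}"
  have U: "openin (top_of_set M) U"
    unfolding U_def Diff_eq using N(1) by (intro openin_Int_open) auto
  have Usub: "U \<subseteq> path_image g" using N by (auto simp: U_def)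
  have U': "openin (top_of_set (path_image g)) U"
    using U Usub g(2) openin_subset_trans by blast
  have "openin (top_of_set {0..1}) (f ` U)"
    using homeomorphism_imp_open_map[OF homeomorphism_symD[OF f]] U' by blast
  moreover have fU: "f ` U \<subseteq> {0..<1}"
  proof
    fix s assume "s \<in> f ` U"
    then obtain x where x: "x \<in> U" "s = f x" by blast
    then have "s \<in> {0..1}" "g s = x"
      using Usub homeomorphism_image2[OF f] homeomorphism_apply2[OF f] by blast+
    then show "s \<in> {0..<1}" using x by (cases "s = 1") (auto simp: U_def pathfinish_def)
  qed
  ultimately have "openin (top_of_set {0..<1}) (f ` U)"
    by (meson atLeastLessThan_subseteq_atLeastAtMost_iff order_refl openin_subset_trans)
  moreover have "openin (top_of_set {0..}) {0..<1::real}"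
  proof -
    have "{0..<1::real} = {0..} \<inter> {..<1}" by auto
    then show ?thesis by (metis openin_open_Int open_lessThan)
  qed
  ultimately have V: "openin (top_of_set {0..}) (f ` U)" using openin_trans by blast
  have "homeomorphism U (f ` U) f g"
    using homeomorphism_of_subsets[OF homeomorphism_symD[OF f] Usub, of "f ` U"] Usub
      homeomorphism_image2[OF f] by blast
  then have "half_line_chart M U f" unfolding half_line_chart_def using U V by blast
  moreover have "f p = 0 \<longleftrightarrow> p = pathstart g"
  proof -
    have "p \<in> path_image g" using p N by auto
    then show ?thesis
      using homeomorphism_apply1[OF f, of 0] homeomorphism_apply2[OF f, of p]
      by (auto simp: pathstart_def)
  qed
  moreover have "p \<in> U" using p by (simp add: U_def)
  ultimately show thesis using that by blast
qed

section \<open>Classification of compact one-manifolds\<close>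

text \<open>
  A connected set inside the manifold that meets an arc in a single point must meet it at an end,
  because the manifold has no room left around the inner points of the arc.
\<close>

lemma arc_touches_at_end:
  fixes M :: "'a::{metric_space, second_countable_topology} set"
  assumes M: "one_manifold_with_boundary M" and z: "arc z" "path_image z \<subseteq> M"
    and T: "connected T" "T \<subseteq> M" "T \<inter> path_image z = {x}" "T \<noteq> {x}"
  shows "x = pathstart z \<or> x = pathfinish z"
proof (rule ccontr)
  assume not_end: "\<not> ?thesis"
  obtain t where t: "t \<in> {0..1}" "x = z t" using T(3) unfolding path_image_def by blast
  then have "0 < t" "t < 1"
    using not_end by (auto simp: pathstart_def pathfinish_def less_le)
  then obtain N where N: "openin (top_of_set M) N" "x \<in> N" "N \<subseteq> path_image z"
    using arc_interior_in_manifold(1)[OF M z] t by blast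
  then obtain W where W: "open W" "N = M \<inter> W" by (auto simp: openin_open)
  have "x islimpt T"
  proof (rule connected_imp_perfect[OF T(1)])
    show "x \<in> T" using T(3) by blast
    then show "T \<noteq> {y}" for y using T(4) by (metis singletonD)
  qed
  then obtain y where "y \<in> T" "y \<in> W" "y \<noteq> x"
    using W N by (auto simp: islimpt_def)
  then show False using W N T by auto
qed

text \<open>
  Each point of the curve is inner to an arc of the curve, so the curve is open as well as closed.
\<close>

lemma closed_curve_eq_component:
  fixes M :: "'a::{real_normed_vector, second_countable_topology} set"
  assumes M: "one_manifold_with_boundary M" and K: "K \<in> components M"
    and S: "closed_curve S" "S \<subseteq> K"
  shows "S = K"
proof -
  have KM: "K \<subseteq> M" using K in_components_subset by blast
  have "\<exists>N. openin (top_of_set M) N \<and> p \<in> N \<and> N \<subseteq> S" if p: "p \<in> S" for p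
  proof -
    obtain g t where g: "arc g" "path_image g \<subseteq> S" "0 < t" "t < 1" "g t = p"
      using interior_point_of_closed_curve[OF S(1) p] by metis
    then show ?thesis
      using arc_interior_in_manifold(1)[OF M g(1) _ g(3,4)] S(2) KM by blast
  qed
  then have "openin (top_of_set M) S" by (subst openin_subopen) blast
  then have "openin (top_of_set K) S" using S(2) KM openin_subset_trans by blast
  moreover have "closedin (top_of_set K) S"
    using closed_curve_topology(2)[OF S(1)] S(2) closed_subset by blast
  moreover have "connected K" using K in_components_connected by blast
  ultimately show ?thesis
    using closed_curve_topology(4)[OF S(1)] unfolding connected_clopen by blast
qed

lemma component_path_component:
  fixes M :: "'a::{t2_space, second_countable_topology} set"
  assumes M: "one_manifold_with_boundary M" and K: "K \<in> components M" "x \<in> K" "y \<in> K"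
  shows "path_component M x y"
proof -
  have KM: "K \<subseteq> M" using K in_components_subset by blast
  let ?P = "path_component_set M x"
  have loc: "\<exists>N. openin (top_of_set M) N \<and> p \<in> N \<and> (\<forall>q\<in>N. path_component M p q)" if p: "p \<in> M" for p
  proof -
    obtain g N where g: "arc g" "path_image g \<subseteq> M" "openin (top_of_set M) N" "p \<in> N" "N \<subseteq> path_image g"
      using arc_neighbourhood_in_manifold[OF M p] by blast
    have "path_connected (path_image g)" using g(1) arc_imp_path path_connected_path_image by blast
    then have "path_component M p q" if "q \<in> N" for q
      using g that by (meson path_component_of_subset path_connected_component subsetD)
    then show ?thesis using g by blast
  qed
  have sub: "?P \<subseteq> M" by (simp add: path_component_subset)
  have "openin (top_of_set M) ?P"
  proof (subst openin_subopen, intro ballI)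
    fix p assume "p \<in> ?P"
    then have p: "path_component M x p" by simp
    then have "p \<in> M" using path_component_mem by metis
    then show "\<exists>T. openin (top_of_set M) T \<and> p \<in> T \<and> T \<subseteq> ?P"
      using loc[of p] p path_component_trans by blast
  qed
  moreover have "openin (top_of_set M) (M - ?P)"
  proof (subst openin_subopen, intro ballI)
    fix p assume "p \<in> M - ?P"
    then have p: "p \<in> M" "\<not> path_component M x p" by auto
    obtain N where N: "openin (top_of_set M) N" "p \<in> N" "\<forall>q\<in>N. path_component M p q"
      using loc[OF p(1)] by (elim exE conjE)
    have "\<not> path_component M x q" if "q \<in> N" for q
      using N(3) that p(2) path_component_sym path_component_trans by metis
    then have "N \<subseteq> M - ?P" using openin_imp_subset[OF N(1)] by auto
    then show "\<exists>T. openin (top_of_set M) T \<and> p \<in> T \<and> T \<subseteq> M - ?P" using N by blast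
  qed
  ultimately have "openin (top_of_set K) (K \<inter> ?P)" "openin (top_of_set K) (K - (K \<inter> ?P))"
    using KM by (auto simp: openin_open)
  then have "openin (top_of_set K) (K \<inter> ?P)" "closedin (top_of_set K) (K \<inter> ?P)"
    by (auto simp: closedin_def)
  moreover have "connected K" using K in_components_connected by blast
  moreover have "x \<in> K \<inter> ?P" using K KM by (auto simp: path_component_refl)
  ultimately have "K \<inter> ?P = K" unfolding connected_clopen by blast
  then show ?thesis using K by auto
qed

text \<open>
  A path from the new point is followed until it first hits the arc. The place of the hit is an end
  of the arc, so the two arcs can be joined there.
\<close>

lemma arc_extends_to_point:
  fixes M :: "'a::euclidean_space set"
  assumes M: "one_manifold_with_boundary M" and z: "arc z" "path_image z \<subseteq> M"
    and y: "path_component M y (pathstart z)"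
  obtains w where "arc w" "path_image w \<subseteq> M" "path_image z \<subseteq> path_image w" "y \<in> path_image w"
proof (cases "y \<in> path_image z")
  case True
  then show thesis using that z by blast
next
  case False
  let ?Z = "path_image z"
  have Z: "closed ?Z" using z(1) by (simp add: closed_arc_image)
  obtain c where c: "path c" "path_image c \<subseteq> M" "pathstart c = y" "pathfinish c = pathstart z"
    using y by (auto simp: path_component_def)
  obtain h where h: "path h" "pathstart h = y" "path_image h \<subseteq> path_image c"
    "path_image h - {pathfinish h} \<subseteq> interior (- ?Z)" "pathfinish h \<in> frontier (- ?Z)"
    using exists_path_subpath_to_frontier[of c "- ?Z"] c False closure_subset
    by (metis ComplD ComplI pathstart_in_path_image subsetD)
  define x where "x = pathfinish h"
  have xZ: "x \<in> ?Z" using h(5) Z 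
    using frontier_subset_closed[OF Z] by (auto simp: x_def frontier_complement)
  have hZ: "path_image h \<inter> ?Z \<subseteq> {x}" using h(4) interior_subset by (auto simp: x_def)
  have "y \<noteq> x" using xZ False by auto
  then obtain a where a: "arc a" "path_image a \<subseteq> path_image h" "pathstart a = y" "pathfinish a = x"
    using path_contains_arc[OF h(1,2)] x_def by metis
  have aZ: "path_image a \<inter> ?Z = {x}" using a hZ xZ pathfinish_in_path_image[of a] by auto
  have aM: "path_image a \<subseteq> M" using a h c by blast
  have "x = pathstart z \<or> x = pathfinish z"
  proof (rule arc_touches_at_end[OF M z _ aM aZ])
    show "connected (path_image a)" using a(1) by (simp add: connected_arc_image)
    show "path_image a \<noteq> {x}" using a(3) \<open>y \<noteq> x\<close> pathstart_in_path_image by blast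
  qed
  then have "\<exists>v. arc_between ?Z x v"
    unfolding arc_between_def using z(1)
    by (metis arc_reversepath path_image_reversepath pathstart_reversepath)
  then obtain v where v: "arc_between ?Z x v" by blast
  have "arc_between (path_image a) y x" unfolding arc_between_def using a by blast
  then have "arc_between (path_image a \<union> ?Z) y v"
    using arc_between_Un v aZ by blast
  then obtain w where "arc w" "path_image w = path_image a \<union> ?Z" "pathstart w = y"
    unfolding arc_between_def by blast
  then show thesis using that[of w] aM z(2) pathstart_in_path_image[of w] by auto
qed

lemma arc_through_finite_set:
  fixes M :: "'a::euclidean_space set"
  assumes M: "one_manifold_with_boundary M" and K: "K \<in> components M" and F: "finite F" "F \<subseteq> K"
  obtains z where "arc z" "path_image z \<subseteq> K" "F \<subseteq> path_image z"
proof -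
  have KM: "K \<subseteq> M" using K in_components_subset by blast
  have inK: "path_image g \<subseteq> K" if "arc g" "path_image g \<subseteq> M" "path_image g \<inter> K \<noteq> {}" for g :: "real \<Rightarrow> 'a"
    using that K components_maximal[OF K] connected_arc_image by blast
  have "\<exists>z. arc z \<and> path_image z \<subseteq> K \<and> F \<subseteq> path_image z"
    using F
  proof (induction F rule: finite_induct)
    case empty
    obtain p where "p \<in> K" using K in_components_nonempty by blast
    then obtain g N where "arc g" "path_image g \<subseteq> M" "p \<in> N" "N \<subseteq> path_image g"
      using arc_neighbourhood_in_manifold[OF M, of p] KM by (metis subsetD)
    then show ?case using inK[of g] \<open>p \<in> K\<close> by blast
  next
    case (insert y F)
    then obtain z where z: "arc z" "path_image z \<subseteq> K" "F \<subseteq> path_image z" by auto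
    have "path_component M y (pathstart z)"
      using component_path_component[OF M K] insert.prems z(2) pathstart_in_path_image by blast
    then obtain w where "arc w" "path_image w \<subseteq> M" "path_image z \<subseteq> path_image w" "y \<in> path_image w"
      using arc_extends_to_point[OF M z(1)] z(2) KM by (metis subset_trans)
    then show ?case using inK[of w] z path_image_nonempty[of z] by blast
  qed
  then show thesis using that by blast
qed

text \<open>
  This cuts from a small arc the piece that closes up a large arc \<open>Z\<close>: the last parameter before \<open>u\<close>
  and the first one after \<open>u\<close> at which the path is in \<open>Z\<close> exist by compactness.
\<close>

lemma gap_of_path:
  fixes A :: "real \<Rightarrow> 'a::t2_space"
  assumes A: "path A" and Z: "closed Z" and ends: "pathstart A \<in> Z" "pathfinish A \<in> Z"
    and u: "u \<in> {0..1}" "A u \<notin> Z"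
  obtains s t where "0 \<le> s" "s < u" "u < t" "t \<le> 1" "A s \<in> Z" "A t \<in> Z"
    "\<And>r. s < r \<Longrightarrow> r < t \<Longrightarrow> A r \<notin> Z"
proof -
  have cA: "continuous_on {0..1} A" using A by (simp add: path_def)
  have "closed ({0..u} \<inter> A -` Z)" "closed ({u..1} \<inter> A -` Z)"
    using cA Z u by (auto intro!: continuous_closed_preimage elim: continuous_on_subset)
  then have c: "compact ({0..u} \<inter> A -` Z)" "compact ({u..1} \<inter> A -` Z)"
    by (simp_all add: compact_eq_bounded_closed bounded_Int)
  have ne: "{0..u} \<inter> A -` Z \<noteq> {}" "{u..1} \<inter> A -` Z \<noteq> {}"
    using ends u by (auto simp: pathstart_def pathfinish_def)
  obtain s where s: "s \<in> {0..u} \<inter> A -` Z" "\<And>r. r \<in> {0..u} \<inter> A -` Z \<Longrightarrow> r \<le> s"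
    using compact_attains_sup[OF c(1) ne(1)] by blast
  obtain t where t: "t \<in> {u..1} \<inter> A -` Z" "\<And>r. r \<in> {u..1} \<inter> A -` Z \<Longrightarrow> t \<le> r"
    using compact_attains_inf[OF c(2) ne(2)] by blast
  have neq: "s \<noteq> u" "t \<noteq> u" using s t u by auto
  show thesis
  proof
    show "0 \<le> s" "s < u" "u < t" "t \<le> 1" "A s \<in> Z" "A t \<in> Z" using s t neq by auto
    show "A r \<notin> Z" if "s < r" "r < t" for r
      using s(2)[of r] t(2)[of r] that s(1) t(1) by (cases "r \<le> u") auto
  qed
qed

text \<open>
  If the component contains a closed curve, it is that curve. Otherwise it is covered by finitely many
  arcs \<open>g p\<close>, and an arc \<open>z\<close> is chosen through all their end points. A gap of some \<open>g p\<close> outside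
  \<open>z\<close> would begin and end at the two ends of \<open>z\<close> and close it up to a curve. So \<open>z\<close> contains
  every \<open>g p\<close> and hence the component.
\<close>

theorem component_of_compact_one_manifold:
  fixes M :: "'a::euclidean_space set"
  assumes M: "one_manifold_with_boundary M" "compact M" "finite (components M)" and K: "K \<in> components M"
  shows "closed_curve K \<and> K \<inter> manifold_boundary M = {} \<or>
    (\<exists>x y. arc_between K x y \<and> K \<inter> manifold_boundary M = {x, y})"
proof (cases "\<exists>S. closed_curve S \<and> S \<subseteq> K")
  case True
  then have cK: "closed_curve K" using closed_curve_eq_component[OF M(1) K] by blast
  have KM: "K \<subseteq> M" using K in_components_subset by blast
  have "p \<notin> manifold_boundary M" if p: "p \<in> K" for p
  proof -
    obtain g t where g: "arc g" "path_image g \<subseteq> K" "0 < t" "t < 1" "g t = p"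
      using interior_point_of_closed_curve[OF cK p] by blast
    then show ?thesis
      using arc_interior_in_manifold(2)[OF M(1) g(1) _ g(3,4)] KM by blast
  qed
  then show ?thesis using cK by blast
next
  case False
  have KM: "K \<subseteq> M" using K in_components_subset by blast
  have clK: "closed K" using K M(2) closed_components compact_imp_closed by blast
  then have "compact K" using KM M(2) by (metis compact_Int_closed inf.absorb2)
  have oK: "openin (top_of_set M) K"
  proof -
    have "K = M - \<Union>(components M - {K})"
      using K components_nonoverlap[of K M] Union_components[of M] by blast
    moreover have "closed (\<Union>(components M - {K}))"
      using M closed_components compact_imp_closed by (intro closed_Union) auto
    ultimately show ?thesis
      by (metis Diff_eq open_Compl openin_open_Int)
  qed
  have inK: "path_image g \<subseteq> K" if "arc g" "path_image g \<subseteq> M" "path_image g \<inter> K \<noteq> {}" for g :: "real \<Rightarrow> 'a"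
    using that components_maximal[OF K] connected_arc_image by blast
  have "\<exists>g W. arc g \<and> path_image g \<subseteq> K \<and> open W \<and> p \<in> W \<and> K \<inter> W \<subseteq> path_image g" if p: "p \<in> K" for p
  proof -
    obtain g N where g: "arc g" "path_image g \<subseteq> M" "openin (top_of_set M) N" "p \<in> N" "N \<subseteq> path_image g"
      using arc_neighbourhood_in_manifold[OF M(1), of p] KM p by (metis subsetD)
    obtain W where W: "open W" "N = M \<inter> W" using g(3) openin_open by blast
    have "path_image g \<inter> K \<noteq> {}" using g(4,5) p by blast
    then have "path_image g \<subseteq> K" by (rule inK[OF g(1,2)])
    moreover have "p \<in> W" "K \<inter> W \<subseteq> path_image g" using W g(4,5) KM by auto
    ultimately show ?thesis using g(1) W(1) by (intro exI[of _ g] exI[of _ W] conjI)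
  qed
  then have "\<forall>p\<in>K. \<exists>q. arc (fst q) \<and> path_image (fst q) \<subseteq> K \<and> open (snd q) \<and> p \<in> snd q
      \<and> K \<inter> snd q \<subseteq> path_image (fst q)"
    by (metis fst_conv snd_conv)
  from bchoice[OF this] obtain q where q: "\<forall>p\<in>K. arc (fst (q p)) \<and> path_image (fst (q p)) \<subseteq> K \<and> open (snd (q p))
      \<and> p \<in> snd (q p) \<and> K \<inter> snd (q p) \<subseteq> path_image (fst (q p))"
    by blast
  define g W where "g p = fst (q p)" and "W p = snd (q p)" for p
  have gW: "arc (g p)" "path_image (g p) \<subseteq> K" "open (W p)" "p \<in> W p" "K \<inter> W p \<subseteq> path_image (g p)"
    if "p \<in> K" for p
    using bspec[OF q that] unfolding g_def W_def by auto
  obtain C where C: "C \<subseteq> K" "finite C" "K \<subseteq> (\<Union>p\<in>C. W p)"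
  proof (rule compactE_image[OF \<open>compact K\<close>, of K W])
    show "K \<subseteq> (\<Union>p\<in>K. W p)" using gW(4) by blast
  qed (use gW(3) in auto)
  define F where "F = (\<lambda>p. pathstart (g p)) ` C \<union> (\<lambda>p. pathfinish (g p)) ` C"
  have "finite F" "F \<subseteq> K"
    using C gW pathstart_in_path_image pathfinish_in_path_image unfolding F_def by blast+
  then obtain z where z: "arc z" "path_image z \<subseteq> K" "F \<subseteq> path_image z"
    using arc_through_finite_set[OF M(1) K] by blast
  have zM: "path_image z \<subseteq> M" using z KM by blast
  have clz: "closed (path_image z)" using z(1) by (simp add: closed_arc_image)
  have cover: "path_image (g p) \<subseteq> path_image z" if p: "p \<in> C" for p
  proof (rule ccontr)
    assume "\<not> ?thesis"
    then obtain u where u: "u \<in> {0..1}" "g p u \<notin> path_image z"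
      unfolding path_image_def[of "g p"] by blast
    have "p \<in> K" using C(1) p by blast
    then have gp: "arc (g p)" "path_image (g p) \<subseteq> K" by (rule gW)+
    have "pathstart (g p) \<in> path_image z" "pathfinish (g p) \<in> path_image z"
      using z(3) p unfolding F_def by auto
    then obtain s t where st: "0 \<le> s" "s < u" "u < t" "t \<le> 1" "g p s \<in> path_image z" "g p t \<in> path_image z"
      "\<And>r. s < r \<Longrightarrow> r < t \<Longrightarrow> g p r \<notin> path_image z"
      using gap_of_path[OF arc_imp_path[OF gp(1)] clz _ _ u] by blast
    have inj: "inj_on (g p) {0..1}" and cont: "continuous_on {0..1} (g p)"
      using gp(1) by (auto simp: arc_def path_def)
    have e: "x = pathstart z \<or> x = pathfinish z"
      if "{a..b} \<subseteq> {s..t}" "a < b" "g p ` {a..b} \<inter> path_image z = {x}" for a b x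
    proof (rule arc_touches_at_end[OF M(1) z(1) zM _ _ that(3)])
      have ab: "{a..b} \<subseteq> {0..1}" using that(1) st by auto
      then show "connected (g p ` {a..b})"
        using cont by (intro connected_continuous_image) (auto intro: continuous_on_subset)
      show "g p ` {a..b} \<subseteq> M" using ab gp(2) KM unfolding path_image_def by blast
      have "g p a \<noteq> g p b" "a \<in> {a..b}" "b \<in> {a..b}" using inj ab that(2) by (auto dest: inj_onD)
      then show "g p ` {a..b} \<noteq> {x}" by (metis imageI singletonD)
    qed
    have 1: "g p s = pathstart z \<or> g p s = pathfinish z"
    proof (rule e[of s u])
      show "g p ` {s..u} \<inter> path_image z = {g p s}"
        using st by auto (metis less_eq_real_def order_le_less_trans)
    qed (use st in auto)
    have 2: "g p t = pathstart z \<or> g p t = pathfinish z"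
    proof (rule e[of u t])
      show "g p ` {u..t} \<inter> path_image z = {g p t}"
        using st by auto (metis less_eq_real_def order_less_le_trans)
    qed (use st in auto)
    have neq: "g p s \<noteq> g p t" using inj st by (auto dest: inj_onD)
    let ?T = "path_image (subpath s t (g p))"
    have T: "?T = g p ` {s..t}" using st by (subst path_image_subpath) auto
    have "arc_between ?T (g p s) (g p t)"
      unfolding arc_between_def
      using arc_subpath_arc[OF gp(1), of s t] st by fastforce
    moreover have "arc_between (path_image z) (g p t) (g p s)"
      using 1 2 neq z(1) unfolding arc_between_def
      by (metis arc_reversepath path_image_reversepath pathfinish_reversepath pathstart_reversepath)
    moreover have "?T \<inter> path_image z \<subseteq> {g p s, g p t}"
      unfolding T using st(7) by (auto simp: less_le) (metis less_le)
    ultimately have "closed_curve (?T \<union> path_image z)" by (rule closed_curve_Un)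
    moreover have "?T \<subseteq> K"
      using path_image_subpath_subset[of s t "g p"] gp(2) st by auto
    ultimately show False using False z(2) by blast
  qed
  have zK: "path_image z = K"
  proof
    show "K \<subseteq> path_image z"
    proof
      fix x assume "x \<in> K"
      then obtain p where "p \<in> C" "x \<in> W p" using C(3) by blast
      then show "x \<in> path_image z" using gW(5)[of p] cover[of p] C(1) \<open>x \<in> K\<close> by (meson IntI subsetD)
    qed
  qed (rule z(2))
  have start: "pathstart w \<in> manifold_boundary M" if w: "arc w" "path_image w = K" for w
  proof -
    have ne: "pathstart w \<noteq> pathfinish w" using arc_distinct_ends[OF w(1)] by auto
    have sK: "pathstart w \<in> K" using pathstart_in_path_image[of w] w(2) by simp
    obtain U f where "pathstart w \<in> U" "half_line_chart M U f" "f (pathstart w) = 0 \<longleftrightarrow> pathstart w = pathstart w"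
      by (rule chart_from_arc[OF w(1) _ oK _ sK ne]) (use w(2) KM in auto)
    then show ?thesis
      unfolding manifold_boundary_def using sK KM by blast
  qed
  have "K \<inter> manifold_boundary M = {pathstart z, pathfinish z}"
  proof
    show "{pathstart z, pathfinish z} \<subseteq> K \<inter> manifold_boundary M"
      using start[of z] start[of "reversepath z"] z(1) zK pathstart_in_path_image[of z]
        pathfinish_in_path_image[of z] by (auto simp: arc_reversepath)
    show "K \<inter> manifold_boundary M \<subseteq> {pathstart z, pathfinish z}"
    proof
      fix x assume x: "x \<in> K \<inter> manifold_boundary M"
      then obtain t where t: "t \<in> {0..1}" "x = z t" using zK by (auto simp: path_image_def)
      have "\<not> (0 < t \<and> t < 1)"
        using arc_interior_in_manifold(2)[OF M(1) z(1) zM, of t] x t(2) by auto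
      then have "t = 0 \<or> t = 1" using t(1) by auto
      then show "x \<in> {pathstart z, pathfinish z}"
        using t(2) by (auto simp: pathstart_def pathfinish_def)
    qed
  qed
  then show ?thesis unfolding arc_between_def using z(1) zK by blast
qed

section \<open>Disjoint unions of arcs and closed curves\<close>

text \<open>
  A disjoint union of arcs and of \<open>k\<close> closed curves. The ends of the arcs are labelled by \<open>J\<close>: the
  end \<open>j\<close> lies at \<open>q j\<close>, and its arc \<open>A j\<close> leads to the end \<open>p j\<close>. As labels and places are separate, an
  end can be moved while the matching \<open>p\<close> of the labels is kept.
\<close>

definition arc_system ::
  "'a::topological_space set \<Rightarrow> nat set \<Rightarrow> (nat \<Rightarrow> nat) \<Rightarrow> (nat \<Rightarrow> 'a) \<Rightarrow> nat \<Rightarrow> bool" where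
  "arc_system D J p q k \<longleftrightarrow> finite J \<and>
     (\<exists>A \<C>. finite \<C> \<and> card \<C> = k \<and>
        (\<forall>j\<in>J. p j \<in> J \<and> p (p j) = j \<and> A (p j) = A j \<and> arc_between (A j) (q j) (q (p j))) \<and>
        (\<forall>i\<in>J. \<forall>j\<in>J. A i \<inter> A j \<noteq> {} \<longrightarrow> j = i \<or> j = p i) \<and>
        (\<forall>S\<in>\<C>. closed_curve S) \<and> pairwise disjnt \<C> \<and> (\<forall>j\<in>J. \<forall>S\<in>\<C>. A j \<inter> S = {}) \<and>
        D = (\<Union>j\<in>J. A j) \<union> \<Union>\<C>)"

lemma arc_systemI:
  assumes "finite J" "finite \<C>" "card \<C> = k"
    "\<And>j. j \<in> J \<Longrightarrow> p j \<in> J" "\<And>j. j \<in> J \<Longrightarrow> p (p j) = j" "\<And>j. j \<in> J \<Longrightarrow> A (p j) = A j"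
    "\<And>j. j \<in> J \<Longrightarrow> arc_between (A j) (q j) (q (p j))"
    "\<And>i j. i \<in> J \<Longrightarrow> j \<in> J \<Longrightarrow> j \<noteq> i \<Longrightarrow> j \<noteq> p i \<Longrightarrow> A i \<inter> A j = {}"
    "\<And>S. S \<in> \<C> \<Longrightarrow> closed_curve S" "pairwise disjnt \<C>"
    "\<And>j S. j \<in> J \<Longrightarrow> S \<in> \<C> \<Longrightarrow> A j \<inter> S = {}"
    "D = (\<Union>j\<in>J. A j) \<union> \<Union>\<C>"
  shows "arc_system D J p q k"
  unfolding arc_system_def
proof (intro conjI exI[of _ A] exI[of _ \<C>] ballI impI)
  show "j = i \<or> j = p i" if "i \<in> J" "j \<in> J" "A i \<inter> A j \<noteq> {}" for i j
    using assms(8)[OF that(1,2)] that(3) by blast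
qed (use assms in auto)

lemma arc_systemE:
  assumes "arc_system D J p q k"
  obtains A \<C> where "finite J" "finite \<C>" "card \<C> = k"
    "\<And>j. j \<in> J \<Longrightarrow> p j \<in> J" "\<And>j. j \<in> J \<Longrightarrow> p (p j) = j" "\<And>j. j \<in> J \<Longrightarrow> A (p j) = A j"
    "\<And>j. j \<in> J \<Longrightarrow> arc_between (A j) (q j) (q (p j))"
    "\<And>i j. i \<in> J \<Longrightarrow> j \<in> J \<Longrightarrow> j \<noteq> i \<Longrightarrow> j \<noteq> p i \<Longrightarrow> A i \<inter> A j = {}"
    "\<And>S. S \<in> \<C> \<Longrightarrow> closed_curve S" "pairwise disjnt \<C>"
    "\<And>j S. j \<in> J \<Longrightarrow> S \<in> \<C> \<Longrightarrow> A j \<inter> S = {}"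
    "D = (\<Union>j\<in>J. A j) \<union> \<Union>\<C>"
proof -
  have fin: "finite J" and ex: "\<exists>A \<C>. finite \<C> \<and> card \<C> = k \<and>
        (\<forall>j\<in>J. p j \<in> J \<and> p (p j) = j \<and> A (p j) = A j \<and> arc_between (A j) (q j) (q (p j))) \<and>
        (\<forall>i\<in>J. \<forall>j\<in>J. A i \<inter> A j \<noteq> {} \<longrightarrow> j = i \<or> j = p i) \<and>
        (\<forall>S\<in>\<C>. closed_curve S) \<and> pairwise disjnt \<C> \<and> (\<forall>j\<in>J. \<forall>S\<in>\<C>. A j \<inter> S = {}) \<and>
        D = (\<Union>j\<in>J. A j) \<union> \<Union>\<C>"
    using assms unfolding arc_system_def by (rule conjunct1) (use assms in \<open>simp only: arc_system_def\<close>)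
  from ex obtain A \<C> where *: "finite \<C> \<and> card \<C> = k \<and>
        (\<forall>j\<in>J. p j \<in> J \<and> p (p j) = j \<and> A (p j) = A j \<and> arc_between (A j) (q j) (q (p j))) \<and>
        (\<forall>i\<in>J. \<forall>j\<in>J. A i \<inter> A j \<noteq> {} \<longrightarrow> j = i \<or> j = p i) \<and>
        (\<forall>S\<in>\<C>. closed_curve S) \<and> pairwise disjnt \<C> \<and> (\<forall>j\<in>J. \<forall>S\<in>\<C>. A j \<inter> S = {}) \<and>
        D = (\<Union>j\<in>J. A j) \<union> \<Union>\<C>"
    by (elim exE) (rule that)
  show thesis
  proof (rule that[of \<C> A])
    show "A i \<inter> A j = {}" if "i \<in> J" "j \<in> J" "j \<noteq> i" "j \<noteq> p i" for i j using * that by blast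
  qed (use fin * in auto)
qed

lemma arc_system_cong:
  assumes "arc_system D J p q k" "\<And>j. j \<in> J \<Longrightarrow> p' j = p j" "\<And>j. j \<in> J \<Longrightarrow> q' j = q j"
  shows "arc_system D J p' q' k"
  using assms(1)
proof (rule arc_systemE)
  fix A \<C>
  assume *: "finite J" "finite \<C>" "card \<C> = k"
    "\<And>j. j \<in> J \<Longrightarrow> p j \<in> J" "\<And>j. j \<in> J \<Longrightarrow> p (p j) = j" "\<And>j. j \<in> J \<Longrightarrow> A (p j) = A j"
    "\<And>j. j \<in> J \<Longrightarrow> arc_between (A j) (q j) (q (p j))"
    "\<And>i j. i \<in> J \<Longrightarrow> j \<in> J \<Longrightarrow> j \<noteq> i \<Longrightarrow> j \<noteq> p i \<Longrightarrow> A i \<inter> A j = {}"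
    "\<And>S. S \<in> \<C> \<Longrightarrow> closed_curve S" "pairwise disjnt \<C>"
    "\<And>j S. j \<in> J \<Longrightarrow> S \<in> \<C> \<Longrightarrow> A j \<inter> S = {}"
    "D = (\<Union>j\<in>J. A j) \<union> \<Union>\<C>"
  show ?thesis
    by (rule arc_systemI[where A = A and \<C> = \<C>]) (simp_all add: * assms(2,3))
qed

lemma arc_system_add_closed_curve:
  assumes "arc_system D J p q k" and S: "closed_curve S" "S \<inter> D = {}"
  shows "arc_system (D \<union> S) J p q (Suc k)"
  using assms(1)
proof (rule arc_systemE)
  fix A \<C>
  assume *: "finite J" "finite \<C>" "card \<C> = k"
    "\<And>j. j \<in> J \<Longrightarrow> p j \<in> J" "\<And>j. j \<in> J \<Longrightarrow> p (p j) = j" "\<And>j. j \<in> J \<Longrightarrow> A (p j) = A j"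
    "\<And>j. j \<in> J \<Longrightarrow> arc_between (A j) (q j) (q (p j))"
    "\<And>i j. i \<in> J \<Longrightarrow> j \<in> J \<Longrightarrow> j \<noteq> i \<Longrightarrow> j \<noteq> p i \<Longrightarrow> A i \<inter> A j = {}"
    "\<And>S. S \<in> \<C> \<Longrightarrow> closed_curve S" "pairwise disjnt \<C>"
    "\<And>j S. j \<in> J \<Longrightarrow> S \<in> \<C> \<Longrightarrow> A j \<inter> S = {}"
    "D = (\<Union>j\<in>J. A j) \<union> \<Union>\<C>"
  have ne: "S \<noteq> {}" using S(1) path_image_nonempty unfolding closed_curve_def by auto
  have dC: "S \<inter> T = {}" if "T \<in> \<C>" for T using S(2) *(12) that by blast
  then have nS: "S \<notin> \<C>" using ne by blast
  show ?thesis
  proof (rule arc_systemI[where A = A and \<C> = "insert S \<C>"])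
    show "card (insert S \<C>) = Suc k" using *(2,3) nS by simp
    show "pairwise disjnt (insert S \<C>)"
      using *(10) dC by (auto simp: pairwise_insert disjnt_def)
    show "A j \<inter> T = {}" if "j \<in> J" "T \<in> insert S \<C>" for j T
      using that *(11)[of j T] S(2) *(12) by blast
    show "D \<union> S = (\<Union>j\<in>J. A j) \<union> \<Union>(insert S \<C>)" using *(12) by auto
    show "closed_curve T" if "T \<in> insert S \<C>" for T using that S(1) *(9) by blast
    show "finite (insert S \<C>)" using * by simp
  qed (fact *)+
qed

lemma arc_system_add_arc:
  assumes "arc_system D J p q k" and B: "arc_between B x y" "B \<inter> D = {}"
    and ij: "i \<notin> J" "j \<notin> J" "i \<noteq> j"
  shows "arc_system (D \<union> B) (insert i (insert j J)) (p(i := j, j := i)) (q(i := x, j := y)) k"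
  using assms(1)
proof (rule arc_systemE)
  fix A \<C>
  assume *: "finite J" "finite \<C>" "card \<C> = k"
    "\<And>j. j \<in> J \<Longrightarrow> p j \<in> J" "\<And>j. j \<in> J \<Longrightarrow> p (p j) = j" "\<And>j. j \<in> J \<Longrightarrow> A (p j) = A j"
    "\<And>j. j \<in> J \<Longrightarrow> arc_between (A j) (q j) (q (p j))"
    "\<And>i j. i \<in> J \<Longrightarrow> j \<in> J \<Longrightarrow> j \<noteq> i \<Longrightarrow> j \<noteq> p i \<Longrightarrow> A i \<inter> A j = {}"
    "\<And>S. S \<in> \<C> \<Longrightarrow> closed_curve S" "pairwise disjnt \<C>"
    "\<And>j S. j \<in> J \<Longrightarrow> S \<in> \<C> \<Longrightarrow> A j \<inter> S = {}"
    "D = (\<Union>j\<in>J. A j) \<union> \<Union>\<C>"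
  have nJ: "l \<noteq> i" "l \<noteq> j" "p l \<noteq> i" "p l \<noteq> j" if "l \<in> J" for l
    using that *(4)[OF that] ij by auto
  have AD: "A l \<subseteq> D" if "l \<in> J" for l using *(12) that by auto
  have CD: "S \<subseteq> D" if "S \<in> \<C>" for S using *(12) that by auto
  have BA: "B \<inter> A l = {}" "A l \<inter> B = {}" if "l \<in> J" for l using B(2) AD[OF that] by blast+
  have BC: "B \<inter> S = {}" if "S \<in> \<C>" for S using B(2) CD[OF that] by blast
  show ?thesis
  proof (rule arc_systemI[where A = "A(i := B, j := B)" and \<C> = \<C>])
    show "D \<union> B = (\<Union>l\<in>insert i (insert j J). (A(i := B, j := B)) l) \<union> \<Union>\<C>"
      using *(12) nJ by auto
    show "(A(i := B, j := B)) l \<inter> (A(i := B, j := B)) m = {}"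
      if "l \<in> insert i (insert j J)" "m \<in> insert i (insert j J)" "m \<noteq> l" "m \<noteq> (p(i := j, j := i)) l"
      for l m
      using that nJ *(8)[of l m] BA ij(3) by (auto split: if_splits)
    show "arc_between ((A(i := B, j := B)) l) ((q(i := x, j := y)) l) ((q(i := x, j := y)) ((p(i := j, j := i)) l))"
      if "l \<in> insert i (insert j J)" for l
      using that nJ[of l] *(7)[of l] B(1) arc_between_sym[OF B(1)] ij(3) by auto
    show "(A(i := B, j := B)) l \<inter> S = {}" if "l \<in> insert i (insert j J)" "S \<in> \<C>" for l S
      using that *(11)[of l S] BC[of S] by (cases "l = i"; cases "l = j") auto
    show "closed_curve S" if "S \<in> \<C>" for S using *(9) that .
    show "(p(i := j, j := i)) l \<in> insert i (insert j J)" if "l \<in> insert i (insert j J)" for l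
      using that *(4)[of l] by (cases "l = i"; cases "l = j") auto
    show "(p(i := j, j := i)) ((p(i := j, j := i)) l) = l"
      "(A(i := B, j := B)) ((p(i := j, j := i)) l) = (A(i := B, j := B)) l"
      if "l \<in> insert i (insert j J)" for l
      using that *(5,6)[of l] nJ[of l] ij(3) by (cases "l = i"; cases "l = j"; simp)+
  qed (simp_all add: *(1-3,10))
qed

lemma disjoint_from_trace:
  assumes "B \<inter> D = P" "T \<subseteq> D" "P \<inter> T = {}"
  shows "B \<inter> T = {}" "T \<inter> B = {}"
  using assms by auto

lemma arc_system_extend:
  assumes "arc_system D J p q k" and B: "arc_between B y (q i)" "B \<inter> D = {q i}" and i: "i \<in> J"
  shows "arc_system (D \<union> B) J p (q(i := y)) k"
  using assms(1)
proof (rule arc_systemE)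
  fix A \<C>
  assume *: "finite J" "finite \<C>" "card \<C> = k"
    "\<And>j. j \<in> J \<Longrightarrow> p j \<in> J" "\<And>j. j \<in> J \<Longrightarrow> p (p j) = j" "\<And>j. j \<in> J \<Longrightarrow> A (p j) = A j"
    "\<And>j. j \<in> J \<Longrightarrow> arc_between (A j) (q j) (q (p j))"
    "\<And>i j. i \<in> J \<Longrightarrow> j \<in> J \<Longrightarrow> j \<noteq> i \<Longrightarrow> j \<noteq> p i \<Longrightarrow> A i \<inter> A j = {}"
    "\<And>S. S \<in> \<C> \<Longrightarrow> closed_curve S" "pairwise disjnt \<C>"
    "\<And>j S. j \<in> J \<Longrightarrow> S \<in> \<C> \<Longrightarrow> A j \<inter> S = {}"
    "D = (\<Union>j\<in>J. A j) \<union> \<Union>\<C>"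
  have pi: "p i \<in> J" "p i \<noteq> i" "p (p i) = i" "A (p i) = A i"
    using * i arc_between_ends(3)[OF *(7)[OF i]] by auto
  have qi: "q i \<in> A i" using arc_between_ends(1)[OF *(7)[OF i]] .
  have pl: "p l \<noteq> i \<and> p l \<noteq> p i" if "l \<in> J" "l \<noteq> i" "l \<noteq> p i" for l
    using that *(5)[of l] *(5)[OF i] by metis
  have AD: "A l \<subseteq> D" if "l \<in> J" for l using *(12) that by auto
  have CD: "S \<subseteq> D" if "S \<in> \<C>" for S using *(12) that by auto
  have BA: "B \<inter> A l = {}" "A l \<inter> B = {}" "A i \<inter> A l = {}" "A l \<inter> A i = {}"
    if l: "l \<in> J" "l \<noteq> i" "l \<noteq> p i" for l
  proof -
    show il: "A i \<inter> A l = {}" by (rule *(8)[OF i l])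
    then show "A l \<inter> A i = {}" by (simp add: Int_commute)
    have "{q i} \<inter> A l = {}" using il qi by auto
    from disjoint_from_trace[OF B(2) AD[OF l(1)] this]
    show "B \<inter> A l = {}" "A l \<inter> B = {}" .
  qed
  have BC: "B \<inter> S = {}" if "S \<in> \<C>" for S
  proof -
    have "{q i} \<inter> S = {}" using *(11)[OF i that] qi by auto
    from disjoint_from_trace(1)[OF B(2) CD[OF that] this] show ?thesis .
  qed
  have "B \<inter> A i \<subseteq> {q i}" using B(2) AD[OF i] by blast
  from arc_between_Un[OF B(1) *(7)[OF i] this] have new: "arc_between (A i \<union> B) y (q (p i))"
    by (simp add: Un_commute)
  let ?A = "A(i := A i \<union> B, p i := A i \<union> B)"
  show ?thesis
  proof (rule arc_systemI[where A = ?A and \<C> = \<C>])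
    show "D \<union> B = (\<Union>l\<in>J. ?A l) \<union> \<Union>\<C>"
    proof -
      have "(\<Union>l\<in>J. ?A l) = (\<Union>l\<in>J. A l) \<union> B" using i pi by (auto split: if_splits)
      then show ?thesis using *(12) by auto
    qed
    show "?A l \<inter> ?A m = {}" if lm: "l \<in> J" "m \<in> J" "m \<noteq> l" "m \<noteq> p l" for l m
    proof -
      consider "l = i \<or> l = p i" "m \<noteq> i" "m \<noteq> p i" | "m = i \<or> m = p i" "l \<noteq> i" "l \<noteq> p i"
        | "l \<noteq> i" "l \<noteq> p i" "m \<noteq> i" "m \<noteq> p i"
        using lm pi by metis
      then show ?thesis
      proof cases
        case 1
        then have "?A l = A i \<union> B" "?A m = A m" by auto
        then show ?thesis using BA[OF lm(2) 1(2,3)] by (simp add: Int_Un_distrib2)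
      next
        case 2
        then have "?A m = A i \<union> B" "?A l = A l" by auto
        then show ?thesis using BA[OF lm(1) 2(2,3)] by (simp add: Int_Un_distrib)
      next
        case 3
        then show ?thesis using *(8)[OF lm] by simp
      qed
    qed
    show "arc_between (?A l) ((q(i := y)) l) ((q(i := y)) (p l))" if l: "l \<in> J" for l
    proof -
      consider "l = i" | "l = p i" | "l \<noteq> i" "l \<noteq> p i" by blast
      then show ?thesis
      proof cases
        case 3
        then show ?thesis using pl[OF l] *(7)[OF l] by auto
      qed (use new arc_between_sym[OF new] pi in auto)
    qed
    show "?A (p l) = ?A l" if l: "l \<in> J" for l
      using pl[OF l] *(6)[OF l] pi by (cases "l = i"; cases "l = p i") auto
    show "?A l \<inter> S = {}" if "l \<in> J" "S \<in> \<C>" for l S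
      using *(11)[OF that] *(11)[OF i that(2)] BC[OF that(2)] by (simp add: Int_Un_distrib2)
  qed (fact *)+
qed

lemma arc_system_close:
  assumes "arc_system D J p q k" and B: "arc_between B (q i) (q j)" "B \<inter> D = {q i, q j}"
    and i: "i \<in> J" "p i = j"
  shows "arc_system (D \<union> B) (J - {i, j}) p q (Suc k)"
  using assms(1)
proof (rule arc_systemE)
  fix A \<C>
  assume *: "finite J" "finite \<C>" "card \<C> = k"
    "\<And>j. j \<in> J \<Longrightarrow> p j \<in> J" "\<And>j. j \<in> J \<Longrightarrow> p (p j) = j" "\<And>j. j \<in> J \<Longrightarrow> A (p j) = A j"
    "\<And>j. j \<in> J \<Longrightarrow> arc_between (A j) (q j) (q (p j))"
    "\<And>i j. i \<in> J \<Longrightarrow> j \<in> J \<Longrightarrow> j \<noteq> i \<Longrightarrow> j \<noteq> p i \<Longrightarrow> A i \<inter> A j = {}"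
    "\<And>S. S \<in> \<C> \<Longrightarrow> closed_curve S" "pairwise disjnt \<C>"
    "\<And>j S. j \<in> J \<Longrightarrow> S \<in> \<C> \<Longrightarrow> A j \<inter> S = {}"
    "D = (\<Union>j\<in>J. A j) \<union> \<Union>\<C>"
  have ij: "arc_between (A i) (q i) (q j)" "A j = A i" "p j = i" "j \<in> J" using * i by metis+
  have pl: "p l \<noteq> i \<and> p l \<noteq> j" if "l \<in> J" "l \<noteq> i" "l \<noteq> j" for l
    using that *(5)[of l] ij i by metis
  have disj: "A i \<inter> A l = {}" "A l \<inter> A i = {}" if "l \<in> J - {i, j}" for l
    using *(8)[of i l] that i by auto
  have AD: "A l \<subseteq> D" if "l \<in> J" for l using *(12) that by auto
  have CD: "S \<subseteq> D" if "S \<in> \<C>" for S using *(12) that by auto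
  have BA: "B \<inter> A l = {}" if "l \<in> J - {i, j}" for l
  proof -
    have "{q i, q j} \<inter> A l = {}" using disj(1)[OF that] arc_between_ends(1,2)[OF ij(1)] by auto
    then show ?thesis using disjoint_from_trace(1)[OF B(2) AD] that by simp
  qed
  have BC: "B \<inter> S = {}" if "S \<in> \<C>" for S
  proof -
    have "{q i, q j} \<inter> S = {}" using *(11)[OF i(1) that] arc_between_ends(1,2)[OF ij(1)] by auto
    from disjoint_from_trace(1)[OF B(2) CD[OF that] this] show ?thesis .
  qed
  have sys: "arc_system ((\<Union>l\<in>J - {i,j}. A l) \<union> \<Union>\<C>) (J - {i, j}) p q k"
  proof (rule arc_systemI[where A = A and \<C> = \<C>])
    show "p l \<in> J - {i, j}" if "l \<in> J - {i, j}" for l using that *(4)[of l] pl[of l] by auto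
    show "finite (J - {i, j})" using *(1) by simp
  qed (use *(2-11) in \<open>simp_all\<close>)
  have curve: "closed_curve (A i \<union> B)"
    using B(2) AD[OF i(1)] by (intro closed_curve_Un[OF ij(1) arc_between_sym[OF B(1)]]) blast
  have "(A i \<union> B) \<inter> A l = {}" if "l \<in> J - {i, j}" for l using disj(1)[OF that] BA[OF that] by blast
  moreover have "(A i \<union> B) \<inter> S = {}" if "S \<in> \<C>" for S using *(11)[OF i(1) that] BC[OF that] by blast
  ultimately have "(A i \<union> B) \<inter> ((\<Union>l\<in>J - {i,j}. A l) \<union> \<Union>\<C>) = {}" by blast
  from arc_system_add_closed_curve[OF sys curve this]
  show ?thesis
  proof (rule back_subst[of "\<lambda>D. arc_system D (J - {i, j}) p q (Suc k)"])
    show "(\<Union>l\<in>J - {i,j}. A l) \<union> \<Union>\<C> \<union> (A i \<union> B) = D \<union> B" 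
    proof -
      have "(\<Union>l\<in>J. A l) = A i \<union> (\<Union>l\<in>J - {i,j}. A l)" using ij(2,4) i(1) by blast
      then show ?thesis using *(12) by blast
    qed
  qed
qed

text \<open>
  An arc between ends of two different arcs fuses three arcs into one, and the two far ends become
  partners.
\<close>

lemma arc_system_join:
  assumes "arc_system D J p q k" and B: "arc_between B (q i) (q j)" "B \<inter> D = {q i, q j}"
    and i: "i \<in> J" "j \<in> J" "i \<noteq> j" "p i \<noteq> j"
  shows "arc_system (D \<union> B) (J - {i, j}) (p(p i := p j, p j := p i)) q k"
  using assms(1)
proof (rule arc_systemE)
  fix A \<C>
  assume *: "finite J" "finite \<C>" "card \<C> = k"
    "\<And>j. j \<in> J \<Longrightarrow> p j \<in> J" "\<And>j. j \<in> J \<Longrightarrow> p (p j) = j" "\<And>j. j \<in> J \<Longrightarrow> A (p j) = A j"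
    "\<And>j. j \<in> J \<Longrightarrow> arc_between (A j) (q j) (q (p j))"
    "\<And>i j. i \<in> J \<Longrightarrow> j \<in> J \<Longrightarrow> j \<noteq> i \<Longrightarrow> j \<noteq> p i \<Longrightarrow> A i \<inter> A j = {}"
    "\<And>S. S \<in> \<C> \<Longrightarrow> closed_curve S" "pairwise disjnt \<C>"
    "\<And>j S. j \<in> J \<Longrightarrow> S \<in> \<C> \<Longrightarrow> A j \<inter> S = {}"
    "D = (\<Union>j\<in>J. A j) \<union> \<Union>\<C>"
  define u v where "u = p i" and "v = p j"
  have uv: "u \<in> J" "v \<in> J" "p u = i" "p v = j" "A u = A i" "A v = A j" "p i = u" "p j = v"
    using * i by (simp_all add: u_def v_def)
  have ai: "arc_between (A i) (q i) (q u)" and aj: "arc_between (A j) (q j) (q v)"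
    using *(7) i by (simp_all add: u_def v_def)
  have dist: "u \<noteq> i" "v \<noteq> j" "u \<noteq> v" "u \<noteq> j" "v \<noteq> i"
    using arc_between_ends(3)[OF ai] arc_between_ends(3)[OF aj] uv i by metis+
  have pl: "p l \<noteq> i \<and> p l \<noteq> j \<and> p l \<noteq> u \<and> p l \<noteq> v" if "l \<in> J - {i,j,u,v}" for l
    using that *(5)[of l] uv by (metis DiffD1 DiffD2 insertCI)
  have disj: "A i \<inter> A l = {}" "A j \<inter> A l = {}" if "l \<in> J - {i, j, u, v}" for l
    using *(8)[of i l] *(8)[of j l] that i uv by auto
  have Aij: "A i \<inter> A j = {}" using *(8)[of i j] i by auto
  have ends: "q i \<in> A i" "q j \<in> A j"
    using arc_between_ends(1) ai aj by blast+
  have AD: "A l \<subseteq> D" if "l \<in> J" for l using *(12) that by auto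
  have CD: "S \<subseteq> D" if "S \<in> \<C>" for S using *(12) that by auto
  have BA: "B \<inter> A l = {}" if "l \<in> J - {i, j, u, v}" for l
  proof -
    have "{q i, q j} \<inter> A l = {}" using disj[OF that] ends by auto
    then show ?thesis using disjoint_from_trace(1)[OF B(2) AD] that by simp
  qed
  have BC: "B \<inter> S = {}" if "S \<in> \<C>" for S
  proof -
    have "{q i, q j} \<inter> S = {}" using *(11)[OF i(1) that] *(11)[OF i(2) that] ends by auto
    from disjoint_from_trace(1)[OF B(2) CD[OF that] this] show ?thesis .
  qed
  define N where "N = A i \<union> B \<union> A j"
  have "A i \<inter> B \<subseteq> {q i}" using B(2) AD[OF i(1)] ends Aij by blast
  with arc_between_Un[OF arc_between_sym[OF ai] B(1)] have "arc_between (A i \<union> B) (q u) (q j)" by simp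
  moreover have "(A i \<union> B) \<inter> A j \<subseteq> {q j}"
  proof -
    have "B \<inter> A j \<subseteq> B \<inter> D" using AD[OF i(2)] by auto
    then have "B \<inter> A j \<subseteq> {q i, q j}" by (simp only: B(2))
    moreover have "q i \<notin> A j" using ends Aij by auto
    ultimately show ?thesis using Aij by auto
  qed
  ultimately have N: "arc_between N (q u) (q v)" unfolding N_def using arc_between_Un aj by blast
  have Ndisj: "N \<inter> A l = {}" "A l \<inter> N = {}" if "l \<in> J - {i, j, u, v}" for l
    using disj[OF that] BA[OF that] unfolding N_def by auto
  let ?A = "A(u := N, v := N)" and ?p = "p(p i := p j, p j := p i)"
  show ?thesis
  proof (rule arc_systemI[where A = ?A and \<C> = \<C>])
    show "D \<union> B = (\<Union>l\<in>J - {i, j}. ?A l) \<union> \<Union>\<C>"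
    proof -
      have "(\<Union>l\<in>J - {i, j}. ?A l) = N \<union> (\<Union>l\<in>J - {i, j, u, v}. A l)"
        using uv dist by (auto split: if_splits)
      moreover have "(\<Union>l\<in>J. A l) = A i \<union> A j \<union> (\<Union>l\<in>J - {i, j, u, v}. A l)"
        using i uv by blast
      ultimately show ?thesis by (simp only: *(12) N_def Un_ac)
    qed
    show "?A l \<inter> ?A m = {}" if lm: "l \<in> J - {i, j}" "m \<in> J - {i, j}" "m \<noteq> l" "m \<noteq> ?p l" for l m
    proof -
      have "?p u = v" "?p v = u" using uv(7,8) dist(3) by simp_all
      then have "l = u \<Longrightarrow> m \<noteq> v" "l = v \<Longrightarrow> m \<noteq> u" using lm(4) by metis+
      then consider "l = u \<or> l = v" "m \<noteq> u" "m \<noteq> v" | "m = u \<or> m = v" "l \<noteq> u" "l \<noteq> v"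
        | "l \<noteq> u" "l \<noteq> v" "m \<noteq> u" "m \<noteq> v"
        using lm(3) by blast
      then show ?thesis
      proof cases
        case 1
        then have "?A l = N" "?A m = A m" by auto
        then show ?thesis using Ndisj(1)[of m] 1 lm by simp
      next
        case 2
        then have "?A m = N" "?A l = A l" by auto
        then show ?thesis using Ndisj(2)[of l] 2 lm by simp
      next
        case 3
        then show ?thesis using *(8)[of l m] lm uv(7,8) by simp
      qed
    qed
    show "arc_between (?A l) (q l) (q (?p l))" if l: "l \<in> J - {i, j}" for l
    proof -
      consider "l = u" | "l = v" | "l \<in> J - {i, j, u, v}" using l by blast
      then show ?thesis
        by cases (use N arc_between_sym[OF N] uv dist *(7)[of l] in auto)
    qed
    show "?A (?p l) = ?A l" "?p (?p l) = l" "?p l \<in> J - {i, j}" if l: "l \<in> J - {i, j}" for l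
    proof -
      consider "l = u" | "l = v" | "l \<in> J - {i, j, u, v}" using l by blast
      then have "?A (?p l) = ?A l \<and> ?p (?p l) = l \<and> ?p l \<in> J - {i, j}"
        by cases (use uv dist pl[of l] *(4-6)[of l] in auto)
      then show "?A (?p l) = ?A l" "?p (?p l) = l" "?p l \<in> J - {i, j}" by blast+
    qed
    show "?A l \<inter> S = {}" if "l \<in> J - {i, j}" "S \<in> \<C>" for l S
      using *(11)[of l S] that *(11)[OF i(1) that(2)] *(11)[OF i(2) that(2)] BC[OF that(2)]
      unfolding N_def by (simp add: Int_Un_distrib2)
    show "finite (J - {i, j})" using *(1) by simp
  qed (fact *)+
qed

lemma arc_system_compact:
  fixes D :: "'a::real_normed_vector set"
  assumes "arc_system D J p q k"
  shows "compact D"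
  using assms
proof (rule arc_systemE)
  fix A \<C>
  assume *: "finite J" "finite \<C>" "\<And>j. j \<in> J \<Longrightarrow> arc_between (A j) (q j) (q (p j))"
    "\<And>S. S \<in> \<C> \<Longrightarrow> closed_curve S" "D = (\<Union>j\<in>J. A j) \<union> \<Union>\<C>"
  have "compact (\<Union>j\<in>J. A j)" using *(1,3) arc_between_topology(1) by (intro compact_UN) auto
  moreover have "compact (\<Union>\<C>)" using *(2,4) closed_curve_topology(1) by (intro compact_Union) auto
  ultimately show ?thesis using *(5) by (simp add: compact_Un)
qed

lemma finite_components_of_finite_connected_cover:
  assumes "finite \<P>" "\<And>P. P \<in> \<P> \<Longrightarrow> connected P" "D = \<Union>\<P>"
  shows "finite (components D)"
proof -
  define c where "c P = connected_component_set D (SOME x. x \<in> P)" for P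
  have "components D \<subseteq> c ` \<P>"
  proof
    fix K assume "K \<in> components D"
    then obtain x where x: "x \<in> D" "K = connected_component_set D x" unfolding components_def by blast
    then obtain P where P: "P \<in> \<P>" "x \<in> P" using assms(3) by blast
    define y where "y = (SOME x. x \<in> P)"
    have "y \<in> P" unfolding y_def using P(2) by (rule someI)
    then have "connected_component D x y"
      using assms(2,3) P unfolding connected_component_def by blast
    then have "K = c P" unfolding x(2) c_def y_def[symmetric] using connected_component_eq[of y D x] by simp
    then show "K \<in> c ` \<P>" using P(1) by blast
  qed
  then show ?thesis using assms(1) finite_surj by blast
qed

lemma arc_system_finite_components:
  fixes D :: "'a::real_normed_vector set"
  assumes "arc_system D J p q k"
  shows "finite (components D)"
  using assms
proof (rule arc_systemE)
  fix A \<C>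
  assume *: "finite J" "finite \<C>" "\<And>j. j \<in> J \<Longrightarrow> arc_between (A j) (q j) (q (p j))"
    "\<And>S. S \<in> \<C> \<Longrightarrow> closed_curve S" "D = (\<Union>j\<in>J. A j) \<union> \<Union>\<C>"
  show ?thesis
  proof (rule finite_components_of_finite_connected_cover)
    show "finite (A ` J \<union> \<C>)" using * by simp
    show "D = \<Union>(A ` J \<union> \<C>)" using *(5) by simp
    show "connected P" if "P \<in> A ` J \<union> \<C>" for P
      using that
    proof
      assume "P \<in> A ` J"
      then obtain j where "j \<in> J" "P = A j" by blast
      then show ?thesis using arc_between_topology(3)[OF *(3)] by simp
    next
      assume "P \<in> \<C>"
      then show ?thesis using closed_curve_topology(3)[OF *(4)] by simp
    qed
  qed
qed

text \<open>
  This makes charts of one piece charts of the whole union.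
\<close>

lemma open_piece:
  fixes D :: "'a::t2_space set"
  assumes "finite \<P>" "\<And>Q. Q \<in> \<P> \<Longrightarrow> closed Q" "\<And>Q. Q \<in> \<P> \<Longrightarrow> Q \<noteq> P \<Longrightarrow> Q \<inter> P = {}" "P \<in> \<P>" "D = \<Union>\<P>"
  shows "openin (top_of_set D) P"
proof -
  have "closed (\<Union>(\<P> - {P}))" using assms(1,2) by (intro closed_Union) auto
  then have "openin (top_of_set D) (D \<inter> - \<Union>(\<P> - {P}))" by (simp add: openin_open_Int open_Compl)
  moreover have "D \<inter> - \<Union>(\<P> - {P}) = P"
  proof
    show "D \<inter> - \<Union>(\<P> - {P}) \<subseteq> P" using assms(5) by auto
    show "P \<subseteq> D \<inter> - \<Union>(\<P> - {P})" using assms(3,4,5) by auto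
  qed
  ultimately show ?thesis by simp
qed

lemma arc_system_open_pieces:
  fixes D :: "'a::real_normed_vector set"
  assumes "finite J" "finite \<C>" "\<And>j. j \<in> J \<Longrightarrow> A (p j) = A j"
    "\<And>j. j \<in> J \<Longrightarrow> arc_between (A j) (q j) (q (p j))"
    "\<And>i j. i \<in> J \<Longrightarrow> j \<in> J \<Longrightarrow> j \<noteq> i \<Longrightarrow> j \<noteq> p i \<Longrightarrow> A i \<inter> A j = {}"
    "\<And>S. S \<in> \<C> \<Longrightarrow> closed_curve S" "pairwise disjnt \<C>"
    "\<And>j S. j \<in> J \<Longrightarrow> S \<in> \<C> \<Longrightarrow> A j \<inter> S = {}"
    "D = (\<Union>j\<in>J. A j) \<union> \<Union>\<C>"
  shows "P \<in> A ` J \<union> \<C> \<Longrightarrow> openin (top_of_set D) P"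
    and "P \<in> A ` J \<union> \<C> \<Longrightarrow> closed P"
    and "P \<in> A ` J \<union> \<C> \<Longrightarrow> Q \<in> A ` J \<union> \<C> \<Longrightarrow> P \<noteq> Q \<Longrightarrow> P \<inter> Q = {}"
proof -
  show cl: "closed P" if "P \<in> A ` J \<union> \<C>" for P
    using that
  proof
    assume "P \<in> A ` J"
    then obtain j where "j \<in> J" "P = A j" by blast
    then show ?thesis using arc_between_topology(2)[OF assms(4)] by simp
  next
    assume "P \<in> \<C>"
    then show ?thesis using closed_curve_topology(2)[OF assms(6)] by simp
  qed
  show dj: "P \<inter> Q = {}" if PQ: "P \<in> A ` J \<union> \<C>" "Q \<in> A ` J \<union> \<C>" "P \<noteq> Q" for P Q
    using PQ(1)
  proof
    assume "P \<in> A ` J"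
    then obtain i where i: "i \<in> J" "P = A i" by blast
    show ?thesis using PQ(2)
    proof
      assume "Q \<in> A ` J"
      then obtain j where j: "j \<in> J" "Q = A j" by blast
      have "j \<noteq> i" "j \<noteq> p i" using PQ(3) i j assms(3)[OF i(1)] by auto
      then show ?thesis using assms(5)[OF i(1) j(1)] i j by simp
    qed (use assms(8) i in simp)
  next
    assume P: "P \<in> \<C>"
    show ?thesis using PQ(2)
    proof
      assume "Q \<in> A ` J"
      then show ?thesis using assms(8) P by (auto simp: Int_commute)
    next
      assume "Q \<in> \<C>"
      then show ?thesis using P PQ(3) assms(7) by (simp add: pairwise_def disjnt_def)
    qed
  qed
  show "openin (top_of_set D) P" if "P \<in> A ` J \<union> \<C>"
  proof (rule open_piece)
    show "finite (A ` J \<union> \<C>)" using assms(1,2) by simp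
    show "D = \<Union>(A ` J \<union> \<C>)" using assms(9) by simp
  qed (use cl dj that in auto)
qed

theorem arc_system_imp_one_manifold:
  fixes D :: "'a::euclidean_space set"
  assumes "arc_system D J p q k"
  shows "one_manifold_with_boundary D" "manifold_boundary D = q ` J"
proof -
  obtain A \<C> where *: "finite J" "finite \<C>" "card \<C> = k"
    "\<And>j. j \<in> J \<Longrightarrow> p j \<in> J" "\<And>j. j \<in> J \<Longrightarrow> p (p j) = j" "\<And>j. j \<in> J \<Longrightarrow> A (p j) = A j"
    "\<And>j. j \<in> J \<Longrightarrow> arc_between (A j) (q j) (q (p j))"
    "\<And>i j. i \<in> J \<Longrightarrow> j \<in> J \<Longrightarrow> j \<noteq> i \<Longrightarrow> j \<noteq> p i \<Longrightarrow> A i \<inter> A j = {}"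
    "\<And>S. S \<in> \<C> \<Longrightarrow> closed_curve S" "pairwise disjnt \<C>"
    "\<And>j S. j \<in> J \<Longrightarrow> S \<in> \<C> \<Longrightarrow> A j \<inter> S = {}"
    "D = (\<Union>j\<in>J. A j) \<union> \<Union>\<C>"
    by (rule arc_systemE[OF assms]) (rule that, assumption+)
  note op = arc_system_open_pieces(1)[OF *(1,2,6-12)]
  have arcs: "\<exists>g. arc g \<and> path_image g = A j \<and> pathstart g = q j \<and> pathfinish g = q (p j)" if "j \<in> J" for j
    using *(7)[OF that] unfolding arc_between_def .
  have AD: "A j \<subseteq> D" if "j \<in> J" for j using *(12) that by auto
  have CD: "S \<subseteq> D" if "S \<in> \<C>" for S using *(12) that by auto
  have startchart: "\<exists>U f. x \<in> U \<and> half_line_chart D U f \<and> (f x = 0 \<longleftrightarrow> x = q j)"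
    if j: "j \<in> J" "x \<in> A j" "x \<noteq> q (p j)" for x j
  proof -
    obtain g where g: "arc g" "path_image g = A j" "pathstart g = q j" "pathfinish g = q (p j)"
      using arcs[OF j(1)] by blast
    have oj: "openin (top_of_set D) (A j)" using op j(1) by blast
    obtain U f where "x \<in> U" "half_line_chart D U f" "f x = 0 \<longleftrightarrow> x = pathstart g"
      by (rule chart_from_arc[OF g(1) _ oj _ j(2)]) (use g AD[OF j(1)] j(3) in auto)
    then show ?thesis using g(3) by auto
  qed
  have curve: "(\<exists>U f. x \<in> U \<and> half_line_chart D U f)" if S: "S \<in> \<C>" "x \<in> S" for x S
  proof -
    obtain g t N where g: "arc g" "path_image g \<subseteq> S" "0 < t" "t < 1" "g t = x"
      "openin (top_of_set S) N" "x \<in> N" "N \<subseteq> path_image g"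
      using interior_point_of_closed_curve[OF *(9)[OF S(1)] S(2)] .
    have "openin (top_of_set D) S" using op S(1) by blast
    then have oN: "openin (top_of_set D) N" using g(6) openin_trans by blast
    have ne: "x \<noteq> pathfinish g"
      using g(1,3-5) unfolding arc_def pathfinish_def by (auto dest!: inj_onD[of g _ t 1])
    have gD: "path_image g \<subseteq> D" using g(2) CD[OF S(1)] by (rule subset_trans)
    obtain U f where "x \<in> U" "half_line_chart D U f" "f x = 0 \<longleftrightarrow> x = pathstart g"
      by (rule chart_from_arc[OF g(1) gD oN g(8,7) ne])
    then show ?thesis by (intro exI conjI)
  qed
  show M: "one_manifold_with_boundary D"
    unfolding one_manifold_with_boundary_def
  proof
    fix x assume "x \<in> D"
    then consider j where "j \<in> J" "x \<in> A j" | S where "S \<in> \<C>" "x \<in> S" using *(12) by blast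
    then show "\<exists>U f. x \<in> U \<and> half_line_chart D U f"
    proof cases
      case 1
      show ?thesis
      proof (cases "x = q (p j)")
        case True
        then have "x \<noteq> q (p (p j))" using *(5)[OF 1(1)] arc_between_ends(3)[OF *(7)[OF 1(1)]] by auto
        moreover have "x \<in> A (p j)" using 1 *(6) by simp
        ultimately show ?thesis using startchart[OF *(4)[OF 1(1)]] by blast
      qed (use startchart[OF 1] in blast)
    qed (use curve in blast)
  qed
  show "manifold_boundary D = q ` J"
  proof
    show "q ` J \<subseteq> manifold_boundary D"
    proof
      fix x assume "x \<in> q ` J"
      then obtain j where j: "j \<in> J" "x = q j" by blast
      note e = arc_between_ends[OF *(7)[OF j(1)]]
      have "\<exists>U f. x \<in> U \<and> half_line_chart D U f \<and> (f x = 0 \<longleftrightarrow> x = q j)"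
        using startchart[OF j(1), of x] e j(2) by simp
      moreover have "x \<in> D" using e(1) j AD[OF j(1)] by auto
      ultimately show "x \<in> manifold_boundary D" unfolding manifold_boundary_def using j(2) by auto
    qed
    show "manifold_boundary D \<subseteq> q ` J"
    proof
      fix x assume xb: "x \<in> manifold_boundary D"
      then have "x \<in> D" unfolding manifold_boundary_def by simp
      then consider j where "j \<in> J" "x \<in> A j" | S where "S \<in> \<C>" "x \<in> S" using *(12) by blast
      then show "x \<in> q ` J"
      proof cases
        case 1
        obtain g where g: "arc g" "path_image g = A j" "pathstart g = q j" "pathfinish g = q (p j)"
          using arcs[OF 1(1)] by blast
        obtain t where t: "t \<in> {0..1}" "x = g t" using 1(2) g(2) unfolding path_image_def by blast
        have "path_image g \<subseteq> D" using AD[OF 1(1)] g(2) by simp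
        then have "\<not> (0 < t \<and> t < 1)" using arc_interior_in_manifold(2)[OF M g(1), of t] xb t(2) by auto
        then have "t = 0 \<or> t = 1" using t(1) by auto
        then have "x = q j \<or> x = q (p j)" using t(2) g(3,4) by (auto simp: pathstart_def pathfinish_def)
        then show ?thesis using 1(1) *(4)[OF 1(1)] by auto
      next
        case 2
        obtain g t N where g: "arc g" "path_image g \<subseteq> S" "0 < t" "t < 1" "g t = x"
          "openin (top_of_set S) N" "x \<in> N" "N \<subseteq> path_image g"
          using interior_point_of_closed_curve[OF *(9)[OF 2(1)] 2(2)] .
        have "path_image g \<subseteq> D" using g(2) CD[OF 2(1)] by blast
        then show ?thesis using arc_interior_in_manifold(2)[OF M g(1) _ g(3,4)] xb g(5) by simp
      qed
    qed
  qed
qed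

text \<open>
  The arc at \<open>j\<close> is the component of \<open>q j\<close>. By the classification this component contains exactly one
  further boundary point, whose label is \<open>p j\<close>.
\<close>

theorem one_manifold_imp_arc_system:
  fixes M :: "'a::euclidean_space set"
  assumes M: "one_manifold_with_boundary M" "compact M" "finite (components M)"
    and J: "finite J" "bij_betw q J (manifold_boundary M)"
  shows "\<exists>p k. arc_system M J p q k"
proof -
  have inj: "q i = q j \<Longrightarrow> i = j" if "i \<in> J" "j \<in> J" for i j
    using J(2) that unfolding bij_betw_def inj_on_def by blast
  have img: "manifold_boundary M = q ` J" using J(2) unfolding bij_betw_def by simp
  have bM: "manifold_boundary M \<subseteq> M" unfolding manifold_boundary_def by auto
  define A where "A j = connected_component_set M (q j)" for j
  have AK: "A j \<in> components M" "q j \<in> A j" if "j \<in> J" for j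
  proof -
    have "q j \<in> M" using img bM that by blast
    then show "A j \<in> components M" "q j \<in> A j"
      unfolding A_def by (auto simp: componentsI connected_component_refl)
  qed
  have "\<exists>i. i \<in> J \<and> arc_between (A j) (q j) (q i) \<and> A j \<inter> manifold_boundary M = {q j, q i}" if j: "j \<in> J" for j
  proof -
    have qj: "q j \<in> A j \<inter> manifold_boundary M" using AK(2)[OF j] img j by blast
    then obtain x y where xy: "arc_between (A j) x y" "A j \<inter> manifold_boundary M = {x, y}"
      using component_of_compact_one_manifold[OF M AK(1)[OF j]] by blast
    then have "\<exists>z. arc_between (A j) (q j) z \<and> A j \<inter> manifold_boundary M = {q j, z}"
      using qj arc_between_sym[OF xy(1)] by (metis insertE insert_commute singletonD)
    then obtain z where z: "arc_between (A j) (q j) z" "A j \<inter> manifold_boundary M = {q j, z}" by blast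
    then have "z \<in> q ` J" using img by blast
    then show ?thesis using z by blast
  qed
  then have "\<forall>j\<in>J. \<exists>i. i \<in> J \<and> arc_between (A j) (q j) (q i) \<and> A j \<inter> manifold_boundary M = {q j, q i}" by blast
  from bchoice[OF this] obtain p where p: "\<forall>j\<in>J. p j \<in> J \<and> arc_between (A j) (q j) (q (p j)) \<and> A j \<inter> manifold_boundary M = {q j, q (p j)}"
    by blast
  have same: "A (p j) = A j" if "j \<in> J" for j
  proof -
    have "q (p j) \<in> A j" using p that arc_between_ends(2) by blast
    then show ?thesis unfolding A_def by (metis connected_component_eq)
  qed
  have pp: "p (p j) = j" if j: "j \<in> J" for j
  proof -
    have pj: "p j \<in> J" using p j by blast
    have "A (p j) \<inter> manifold_boundary M = {q (p j), q (p (p j))}" using p pj by blast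
    moreover have "A j \<inter> manifold_boundary M = {q j, q (p j)}" using p j by blast
    ultimately have "{q (p j), q (p (p j))} = {q j, q (p j)}" using same[OF j] by simp
    moreover have "q (p j) \<noteq> q (p (p j))" using p pj arc_between_ends(3) by blast
    ultimately have "q (p (p j)) = q j" by (auto simp: doubleton_eq_iff)
    then show ?thesis using inj p pj j by blast
  qed
  define \<C> where "\<C> = {K \<in> components M. closed_curve K \<and> K \<inter> manifold_boundary M = {}}"
  have disj: "K \<inter> L = {}" if "K \<in> components M" "L \<in> components M" "K \<noteq> L" for K L
    using components_nonoverlap that by blast
  have "arc_system M J p q (card \<C>)"
  proof (rule arc_systemI[where A = A and \<C> = \<C>])
    show "finite \<C>" unfolding \<C>_def using M(3) by simp
    show "A i \<inter> A j = {}" if ij: "i \<in> J" "j \<in> J" "j \<noteq> i" "j \<noteq> p i" for i j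
    proof (rule disj)
      show "A i \<noteq> A j"
      proof
        assume eq: "A i = A j"
        have "A i \<inter> manifold_boundary M = {q i, q (p i)}" using p ij(1) by blast
        moreover have "q j \<in> A j" "q j \<in> manifold_boundary M" using AK(2)[OF ij(2)] img ij(2) by auto
        ultimately have "q j = q i \<or> q j = q (p i)" using eq by blast
        then show False using inj ij p by blast
      qed
    qed (use AK ij in auto)
    show "pairwise disjnt \<C>" unfolding pairwise_def disjnt_def \<C>_def using disj by blast
    show "A j \<inter> S = {}" if "j \<in> J" "S \<in> \<C>" for j S
    proof (rule disj)
      have "q j \<in> A j" "q j \<notin> S" using AK(2)[OF that(1)] img that unfolding \<C>_def by auto
      then show "A j \<noteq> S" by blast
    qed (use AK that \<C>_def in auto)
    show "M = (\<Union>j\<in>J. A j) \<union> \<Union>\<C>"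
    proof
      have "A j \<subseteq> M" if "j \<in> J" for j using AK(1)[OF that] in_components_subset by blast
      moreover have "S \<subseteq> M" if "S \<in> \<C>" for S using that in_components_subset unfolding \<C>_def by blast
      ultimately show "(\<Union>j\<in>J. A j) \<union> \<Union>\<C> \<subseteq> M" by blast
      show "M \<subseteq> (\<Union>j\<in>J. A j) \<union> \<Union>\<C>"
      proof
        fix x assume "x \<in> M"
        then obtain K where K: "K \<in> components M" "x \<in> K" using Union_components[of M] by blast
        show "x \<in> (\<Union>j\<in>J. A j) \<union> \<Union>\<C>"
        proof (cases "K \<inter> manifold_boundary M = {}")
          case True
          then have "K \<in> \<C>" using component_of_compact_one_manifold[OF M K(1)] K(1) unfolding \<C>_def by blast
          then show ?thesis using K(2) by blast
        next
          case False
          then have "K \<inter> q ` J \<noteq> {}" by (simp only: img not_False_eq_True)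
          then obtain j where j: "j \<in> J" "q j \<in> K" by auto
          have "K \<inter> A j \<noteq> {}" using j(2) AK(2)[OF j(1)] by auto
          then have "K = A j" using disj[OF K(1) AK(1)[OF j(1)]] by metis
          then show ?thesis using K(2) j(1) by auto
        qed
      qed
    qed
  qed (use J p pp same in \<open>auto simp: \<C>_def\<close>)
  then show ?thesis by blast
qed

lemma glue_on_disjoint_pieces:
  fixes \<phi> :: "'a::t2_space set \<Rightarrow> 'a \<Rightarrow> 'b::t2_space"
  assumes fin: "finite \<P>" and comp: "\<And>P. P \<in> \<P> \<Longrightarrow> compact P"
    and disj: "\<And>P Q. P \<in> \<P> \<Longrightarrow> Q \<in> \<P> \<Longrightarrow> P \<noteq> Q \<Longrightarrow> P \<inter> Q = {}"
    and cont: "\<And>P. P \<in> \<P> \<Longrightarrow> continuous_on P (\<phi> P)"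
    and inj: "\<And>P. P \<in> \<P> \<Longrightarrow> inj_on (\<phi> P) P"
    and disj': "\<And>P Q. P \<in> \<P> \<Longrightarrow> Q \<in> \<P> \<Longrightarrow> P \<noteq> Q \<Longrightarrow> \<phi> P ` P \<inter> \<phi> Q ` Q = {}"
  obtains f g where "homeomorphism (\<Union>\<P>) (\<Union>P\<in>\<P>. \<phi> P ` P) f g"
    "\<And>P x. P \<in> \<P> \<Longrightarrow> x \<in> P \<Longrightarrow> f x = \<phi> P x"
proof -
  define f where "f x = \<phi> (THE P. P \<in> \<P> \<and> x \<in> P) x" for x
  have f: "f x = \<phi> P x" if "P \<in> \<P>" "x \<in> P" for P x
  proof -
    have "(THE P. P \<in> \<P> \<and> x \<in> P) = P" using that disj by (intro the_equality) blast+
    then show ?thesis by (simp add: f_def)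
  qed
  have "continuous_on (\<Union>P\<in>\<P>. P) f"
  proof (rule continuous_on_closed_Union[OF fin])
    show "closed P" if "P \<in> \<P>" for P using comp[OF that] by (rule compact_imp_closed)
    show "continuous_on P f" if "P \<in> \<P>" for P
      using cont[OF that] f[OF that] by (simp cong: continuous_on_cong)
  qed
  moreover have "compact (\<Union>\<P>)" using fin comp by (intro compact_Union) auto
  moreover have "f ` \<Union>\<P> = (\<Union>P\<in>\<P>. \<phi> P ` P)" using f by (force simp: image_iff)
  moreover have "inj_on f (\<Union>\<P>)"
  proof (rule inj_onI)
    fix x y assume xy: "x \<in> \<Union>\<P>" "y \<in> \<Union>\<P>" "f x = f y"
    then obtain P Q where PQ: "P \<in> \<P>" "x \<in> P" "Q \<in> \<P>" "y \<in> Q" by blast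
    then have e: "\<phi> P x = \<phi> Q y" using xy f by metis
    then have "P = Q" using disj'[OF PQ(1,3)] PQ(2,4) by (metis disjoint_iff image_eqI)
    then show "x = y" using e inj[OF PQ(1)] PQ by (auto dest: inj_onD)
  qed
  ultimately obtain g where "homeomorphism (\<Union>\<P>) (\<Union>P\<in>\<P>. \<phi> P ` P) f g"
    using homeomorphism_compact[of "\<Union>\<P>" f] by auto
  then show thesis using that f by blast
qed

lemma arc_between_map:
  fixes S :: "'a::t2_space set" and T :: "'b::t2_space set"
  assumes "arc_between S x y" "arc_between T u v"
  obtains f where "continuous_on S f" "inj_on f S" "f ` S = T" "f x = u" "f y = v"
proof -
  obtain g where g: "arc g" "path_image g = S" "pathstart g = x" "pathfinish g = y"
    using assms(1) unfolding arc_between_def by blast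
  obtain h where h: "arc h" "path_image h = T" "pathstart h = u" "pathfinish h = v"
    using assms(2) unfolding arc_between_def by blast
  obtain g' where g': "homeomorphism {0..1} S g g'" using homeomorphism_arc[OF g(1)] g(2) by blast
  obtain h' where h': "homeomorphism {0..1} T h h'" using homeomorphism_arc[OF h(1)] h(2) by blast
  have *: "homeomorphism S T (h \<circ> g') (g \<circ> h')"
    using homeomorphism_compose[OF homeomorphism_symD[OF g'] h'] .
  show thesis
  proof
    show "continuous_on S (h \<circ> g')" "(h \<circ> g') ` S = T" using * by (auto simp: homeomorphism_def)
    show "inj_on (h \<circ> g') S" using homeomorphism_apply1[OF *] by (rule inj_on_inverseI)
    show "(h \<circ> g') x = u" "(h \<circ> g') y = v"
      using g h homeomorphism_apply1[OF g', of 0] homeomorphism_apply1[OF g', of 1]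
      by (auto simp: pathstart_def pathfinish_def)
  qed
qed

lemma closed_curve_map:
  fixes S :: "'a::t2_space set" and T :: "'b::t2_space set"
  assumes "closed_curve S" "closed_curve T"
  obtains f where "continuous_on S f" "inj_on f S" "f ` S = T"
proof -
  have "S homeomorphic T"
    using assms homeomorphic_simple_path_images unfolding closed_curve_def by metis
  then obtain f f' where *: "homeomorphism S T f f'" unfolding homeomorphic_def by blast
  show thesis
  proof
    show "continuous_on S f" "f ` S = T" using * by (auto simp: homeomorphism_def)
    show "inj_on f S" using homeomorphism_apply1[OF *] by (rule inj_on_inverseI)
  qed
qed

text \<open>
  Arcs are mapped to arcs with the same labels at their ends. Both labels of an arc belong to the same
  component, so the map has to be chosen for components, not for labels.
\<close>

theorem arc_system_equivalence:
  fixes D :: "'a::real_normed_vector set" and D' :: "'b::real_normed_vector set"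
  assumes D: "arc_system D J p q k" and D': "arc_system D' J p q' k"
  obtains f g where "homeomorphism D D' f g" "\<And>j. j \<in> J \<Longrightarrow> f (q j) = q' j"
proof -
  obtain A \<C> where *: "finite J" "finite \<C>" "card \<C> = k"
    "\<And>j. j \<in> J \<Longrightarrow> p j \<in> J" "\<And>j. j \<in> J \<Longrightarrow> p (p j) = j" "\<And>j. j \<in> J \<Longrightarrow> A (p j) = A j"
    "\<And>j. j \<in> J \<Longrightarrow> arc_between (A j) (q j) (q (p j))"
    "\<And>i j. i \<in> J \<Longrightarrow> j \<in> J \<Longrightarrow> j \<noteq> i \<Longrightarrow> j \<noteq> p i \<Longrightarrow> A i \<inter> A j = {}"
    "\<And>S. S \<in> \<C> \<Longrightarrow> closed_curve S" "pairwise disjnt \<C>"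
    "\<And>j S. j \<in> J \<Longrightarrow> S \<in> \<C> \<Longrightarrow> A j \<inter> S = {}"
    "D = (\<Union>j\<in>J. A j) \<union> \<Union>\<C>"
    by (rule arc_systemE[OF D]) (rule that, assumption+)
  obtain A' \<C>' where **: "finite J" "finite \<C>'" "card \<C>' = k"
    "\<And>j. j \<in> J \<Longrightarrow> p j \<in> J" "\<And>j. j \<in> J \<Longrightarrow> p (p j) = j" "\<And>j. j \<in> J \<Longrightarrow> A' (p j) = A' j"
    "\<And>j. j \<in> J \<Longrightarrow> arc_between (A' j) (q' j) (q' (p j))"
    "\<And>i j. i \<in> J \<Longrightarrow> j \<in> J \<Longrightarrow> j \<noteq> i \<Longrightarrow> j \<noteq> p i \<Longrightarrow> A' i \<inter> A' j = {}"
    "\<And>S. S \<in> \<C>' \<Longrightarrow> closed_curve S" "pairwise disjnt \<C>'"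
    "\<And>j S. j \<in> J \<Longrightarrow> S \<in> \<C>' \<Longrightarrow> A' j \<inter> S = {}"
    "D' = (\<Union>j\<in>J. A' j) \<union> \<Union>\<C>'"
    by (rule arc_systemE[OF D']) (rule that, assumption+)
  note pieces = arc_system_open_pieces[OF *(1,2,6-12)]
  note pieces' = arc_system_open_pieces[OF **(1,2,6-12)]
  obtain \<beta> where \<beta>: "bij_betw \<beta> \<C> \<C>'"
    using finite_same_card_bij[OF *(2) **(2)] *(3) **(3) by auto
  have qA: "q j \<in> A j" if "j \<in> J" for j using arc_between_ends(1)[OF *(7)[OF that]] .
  have "\<exists>h. continuous_on P h \<and> inj_on h P \<and> (\<forall>j\<in>J. A j = P \<longrightarrow> h ` P = A' j \<and> h (q j) = q' j) \<and> (P \<in> \<C> \<longrightarrow> h ` P = \<beta> P)"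
    if P: "P \<in> A ` J \<union> \<C>" for P
    using P
  proof
    assume "P \<in> A ` J"
    then obtain i where i: "i \<in> J" "P = A i" by blast
    obtain h where h: "continuous_on P h" "inj_on h P" "h ` P = A' i" "h (q i) = q' i" "h (q (p i)) = q' (p i)"
      using arc_between_map[OF *(7)[OF i(1)] **(7)[OF i(1)]] i(2) by blast
    have "P \<notin> \<C>" using *(11)[OF i(1)] qA[OF i(1)] i(2) by auto
    moreover have "h ` P = A' j \<and> h (q j) = q' j" if j: "j \<in> J" "A j = P" for j
    proof -
      have "A i \<inter> A j \<noteq> {}" using qA[OF i(1)] j i by auto
      then have "j = i \<or> j = p i" using *(8)[OF i(1) j(1)] by metis
      then show ?thesis using h **(6)[OF i(1)] by auto
    qed
    ultimately show ?thesis using h(1,2) by blast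
  next
    assume P: "P \<in> \<C>"
    then have "\<beta> P \<in> \<C>'" using \<beta> by (auto simp: bij_betw_def)
    then obtain h where h: "continuous_on P h" "inj_on h P" "h ` P = \<beta> P"
      using closed_curve_map[OF *(9)[OF P] **(9)] by metis
    have "A j \<noteq> P" if "j \<in> J" for j using *(11)[OF that P] qA[OF that] by auto
    then show ?thesis using h by blast
  qed
  then have "\<forall>P\<in>A ` J \<union> \<C>. \<exists>h. continuous_on P h \<and> inj_on h P \<and>
      (\<forall>j\<in>J. A j = P \<longrightarrow> h ` P = A' j \<and> h (q j) = q' j) \<and> (P \<in> \<C> \<longrightarrow> h ` P = \<beta> P)"
    by blast
  from bchoice[OF this] obtain \<phi> where \<phi>: "\<forall>P\<in>A ` J \<union> \<C>. continuous_on P (\<phi> P) \<and> inj_on (\<phi> P) P \<and>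
      (\<forall>j\<in>J. A j = P \<longrightarrow> \<phi> P ` P = A' j \<and> \<phi> P (q j) = q' j) \<and> (P \<in> \<C> \<longrightarrow> \<phi> P ` P = \<beta> P)"
    by blast
  have \<phi>A: "\<phi> (A j) ` A j = A' j" "\<phi> (A j) (q j) = q' j" if "j \<in> J" for j using \<phi> that by blast+
  have \<phi>C: "\<phi> S ` S = \<beta> S" if "S \<in> \<C>" for S using \<phi> that by blast
  have \<beta>C: "\<beta> S \<in> \<C>'" if "S \<in> \<C>" for S using \<beta> that by (auto simp: bij_betw_def)
  have distinct: "\<phi> P ` P \<inter> \<phi> Q ` Q = {}" if PQ: "P \<in> A ` J \<union> \<C>" "Q \<in> A ` J \<union> \<C>" "P \<noteq> Q" for P Q
  proof -
    consider i j where "i \<in> J" "j \<in> J" "P = A i" "Q = A j" | i where "i \<in> J" "P = A i" "Q \<in> \<C>"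
      | j where "P \<in> \<C>" "j \<in> J" "Q = A j" | "P \<in> \<C>" "Q \<in> \<C>"
      using PQ(1,2) by blast
    then show ?thesis
    proof cases
      case 1
      then have "j \<noteq> i" "j \<noteq> p i" using PQ(3) *(6)[OF 1(1)] by auto
      then show ?thesis using **(8)[OF 1(1,2)] 1 \<phi>A by simp
    next
      case 2
      then show ?thesis using **(11)[OF 2(1) \<beta>C] \<phi>A \<phi>C by simp
    next
      case 3
      then show ?thesis using **(11)[OF 3(2) \<beta>C] \<phi>A \<phi>C by (simp add: Int_commute)
    next
      case 4
      then have "\<beta> P \<noteq> \<beta> Q" using \<beta> PQ(3) by (auto simp: bij_betw_def inj_on_def)
      then show ?thesis using **(10) \<beta>C 4 \<phi>C by (simp add: pairwise_def disjnt_def)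
    qed
  qed
  have cpt: "compact P" if "P \<in> A ` J \<union> \<C>" for P
    using that
  proof
    assume "P \<in> A ` J"
    then obtain j where "j \<in> J" "P = A j" by blast
    then show ?thesis using arc_between_topology(1)[OF *(7)] by simp
  next
    assume "P \<in> \<C>"
    then show ?thesis using closed_curve_topology(1)[OF *(9)] by simp
  qed
  have fin: "finite (A ` J \<union> \<C>)" using *(1,2) by simp
  obtain f g where fg: "homeomorphism (\<Union>(A ` J \<union> \<C>)) (\<Union>P\<in>A ` J \<union> \<C>. \<phi> P ` P) f g"
    "\<And>P x. P \<in> A ` J \<union> \<C> \<Longrightarrow> x \<in> P \<Longrightarrow> f x = \<phi> P x"
    by (rule glue_on_disjoint_pieces[OF fin cpt pieces(3) _ _ distinct])
       (use \<phi> in \<open>blast | assumption\<close>)+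
  have "(\<Union>P\<in>A ` J \<union> \<C>. \<phi> P ` P) = (\<Union>j\<in>J. A' j) \<union> (\<Union>S\<in>\<C>. \<beta> S)"
    using \<phi>A(1) \<phi>C by (simp add: UN_Un)
  also have "(\<Union>S\<in>\<C>. \<beta> S) = \<Union>\<C>'" using \<beta> by (auto simp: bij_betw_def)
  finally have "(\<Union>P\<in>A ` J \<union> \<C>. \<phi> P ` P) = D'" using **(12) by simp
  moreover have "\<Union>(A ` J \<union> \<C>) = D" using *(12) by simp
  ultimately have "homeomorphism D D' f g" using fg(1) by simp
  moreover have "f (q j) = q' j" if "j \<in> J" for j
    using fg(2)[of "A j" "q j"] that qA[OF that] \<phi>A(2)[OF that] by simp
  ultimately show thesis using that by blast
qed


section \<open>The matching realized by a diagram\<close>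

text \<open>
  The marked points are numbered in the order in which they are met on the way along the bottom
  from left to right and back along the top from right to left. Thus \<open>j\<close> and \<open>2 * n + 1 - j\<close> lie
  above each other, and a crossing is an interlacing of numbers.
\<close>

definition boundary_point :: "nat \<Rightarrow> real \<Rightarrow> nat \<Rightarrow> real \<times> real" where
  "boundary_point n a j = (if j \<le> n then (real j, 0) else (real (2 * n + 1 - j), a))"

lemma boundary_point_image:
  "boundary_point n a ` {1..2 * n} = marked_points n a \<union> marked_points n 0"
proof
  show "boundary_point n a ` {1..2 * n} \<subseteq> marked_points n a \<union> marked_points n 0"
  proof
    fix x assume "x \<in> boundary_point n a ` {1..2 * n}"
    then obtain j where j: "j \<in> {1..2*n}" "x = boundary_point n a j" by blast
    show "x \<in> marked_points n a \<union> marked_points n 0"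
    proof (cases "j \<le> n")
      case True
      then show ?thesis using j by (auto simp: boundary_point_def marked_points_def)
    next
      case False
      then have "2 * n + 1 - j \<in> {1..n}" using j by auto
      moreover have "x = (real (2 * n + 1 - j), a)" using j(2) False by (simp only: boundary_point_def if_False)
      ultimately show ?thesis unfolding marked_points_def by blast
    qed
  qed
  show "marked_points n a \<union> marked_points n 0 \<subseteq> boundary_point n a ` {1..2 * n}"
  proof
    fix x assume "x \<in> marked_points n a \<union> marked_points n 0"
    then consider i where "i \<in> {1..n}" "x = (real i, a)" | i where "i \<in> {1..n}" "x = (real i, 0)"
      unfolding marked_points_def by blast
    then show "x \<in> boundary_point n a ` {1..2 * n}"
    proof cases
      case 1
      then have "x = boundary_point n a (2 * n + 1 - i)" by (auto simp: boundary_point_def)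
      moreover have "2 * n + 1 - i \<in> {1..2 * n}" using 1 by auto
      ultimately show ?thesis by blast
    next
      case 2
      then have "x = boundary_point n a i" "i \<in> {1..2 * n}" by (auto simp: boundary_point_def)
      then show ?thesis by blast
    qed
  qed
qed

lemma inj_on_boundary_point: "a > 0 \<Longrightarrow> inj_on (boundary_point n a) {1..2 * n}"
  by (rule inj_onI) (auto simp: boundary_point_def split: if_splits)

definition realizes :: "nat \<Rightarrow> real \<Rightarrow> (real \<times> real) set \<Rightarrow> (nat \<Rightarrow> nat) \<Rightarrow> nat \<Rightarrow> bool" where
  "realizes n a D p k \<longleftrightarrow> a > 0 \<and> D \<subseteq> rect n a \<and>
     D \<inter> ({0..real n + 1} \<times> {a}) = marked_points n a \<and>
     D \<inter> ({0..real n + 1} \<times> {0}) = marked_points n 0 \<and>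
     arc_system D {1..2 * n} p (boundary_point n a) k"

lemma realizes_imp_n_diagram: "realizes n a D p k \<Longrightarrow> n_diagram n a D"
  unfolding realizes_def n_diagram_def
  using arc_system_compact arc_system_finite_components arc_system_imp_one_manifold boundary_point_image
  by metis

lemma n_diagram_imp_realizes:
  assumes "n_diagram n a D" obtains p k where "realizes n a D p k"
proof -
  note D = assms[unfolded n_diagram_def]
  have bij: "bij_betw (boundary_point n a) {1..2 * n} (manifold_boundary D)"
    using D inj_on_boundary_point boundary_point_image unfolding bij_betw_def by auto
  have "\<exists>p k. arc_system D {1..2 * n} p (boundary_point n a) k"
    using D by (intro one_manifold_imp_arc_system bij) auto
  then have "\<exists>p k. realizes n a D p k" unfolding realizes_def using D by simp
  then show thesis using that by (elim exE)
qed

lemma realizes_imp_diagram_equiv: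
  assumes "realizes n a D p k" "realizes n b E p k"
  shows "diagram_equiv n a D b E"
proof -
  obtain f g where fg: "homeomorphism D E f g" "\<And>j. j \<in> {1..2 * n} \<Longrightarrow> f (boundary_point n a j) = boundary_point n b j"
    using arc_system_equivalence assms unfolding realizes_def by metis
  have "f (real i, 0) = (real i, 0) \<and> f (real i, a) = (real i, b)" if i: "i \<in> {1..n}" for i
  proof -
    have "2 * n + 1 - i \<in> {1..2 * n}" "\<not> 2 * n + 1 - i \<le> n" "2 * n + 1 - (2 * n + 1 - i) = i" using i by auto
    then show ?thesis
      using fg(2)[of i] fg(2)[of "2 * n + 1 - i"] i by (simp add: boundary_point_def)
  qed
  then show ?thesis unfolding diagram_equiv_def using fg(1) by blast
qed


section \<open>Matchings of diagrams have no crossings\<close>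

definition noncrossing :: "nat \<Rightarrow> (nat \<Rightarrow> nat) \<Rightarrow> bool" where
  "noncrossing n p \<longleftrightarrow> (\<forall>x\<in>{1..2 * n}. \<forall>y\<in>{1..2 * n}. \<not> (x < y \<and> y < p x \<and> p x < p y))"

text \<open>
  Polar coordinates with radius \<open>n + 2 - x\<close> and angle \<open>pi * (1 - y / a)\<close>. The bottom of the rectangle
  goes to the negative half of the axis and the top to the positive half, so that the
  marked points appear on the axis in the order of their numbers.
\<close>

definition fan :: "nat \<Rightarrow> real \<Rightarrow> real \<times> real \<Rightarrow> real ^ 2" where
  "fan n a = (\<lambda>(x, y). \<chi> i. if i = 1 then - ((real n + 2 - x) * cos (pi * y / a)) else (real n + 2 - x) * sin (pi * y / a))"

lemma continuous_on_fan: "continuous_on S (fan n a)"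
proof -
  have "continuous_on S (\<lambda>z. if i = 1 then - ((real n + 2 - fst z) * cos (pi * snd z / a)) else (real n + 2 - fst z) * sin (pi * snd z / a))"
    for i :: 2
    by (cases "i = 1") (auto simp: divide_inverse intro!: continuous_intros)
  then show ?thesis unfolding fan_def case_prod_unfold by (intro continuous_on_vec_lambda)
qed

lemma inj_on_fan: assumes "a > 0" shows "inj_on (fan n a) (rect n a)"
proof (rule inj_onI, clarify)
  fix x y x' y' assume xy: "(x, y) \<in> rect n a" "(x', y') \<in> rect n a" "fan n a (x, y) = fan n a (x', y')"
  let ?r = "real n + 2 - x" and ?r' = "real n + 2 - x'" and ?t = "pi * y / a" and ?t' = "pi * y' / a"
  have r: "?r > 0" "?r' > 0" using xy by (auto simp: rect_def)
  have t: "0 \<le> ?t" "?t \<le> pi" "0 \<le> ?t'" "?t' \<le> pi"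
    using xy assms by (auto simp: rect_def field_simps)
  have c: "?r * cos ?t = ?r' * cos ?t'"
    using arg_cong[OF xy(3), of "\<lambda>v. v $ 1"] by (simp only: fan_def split_conv vec_lambda_beta refl if_True neg_equal_iff_equal)
  have s: "?r * sin ?t = ?r' * sin ?t'"
    using arg_cong[OF xy(3), of "\<lambda>v. v $ 2"] by (simp add: fan_def)
  have "?r\<^sup>2 = (?r * cos ?t)\<^sup>2 + (?r * sin ?t)\<^sup>2"
    by (simp only: power_mult_distrib distrib_left[symmetric] cos_squared_eq) simp
  also have "\<dots> = (?r' * cos ?t')\<^sup>2 + (?r' * sin ?t')\<^sup>2" by (simp only: c s)
  also have "\<dots> = ?r'\<^sup>2"
    by (simp only: power_mult_distrib distrib_left[symmetric] cos_squared_eq) simp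
  finally have rr: "?r = ?r'" using r by (simp add: power2_eq_iff_nonneg)
  then have "cos ?t = cos ?t'" using c r by simp
  then have "?t = ?t'" using t cos_inj_pi by blast
  then show "x = x' \<and> y = y'" using rr assms by simp
qed

lemma fan_boundary_point:
  assumes "a > 0" "j \<in> {1..2 * n}"
  shows "fan n a (boundary_point n a j) $ 1 = (if j \<le> n then real j - real n - 2 else real j + 1 - real n)"
    and "fan n a (boundary_point n a j) $ 2 = 0"
  using assms by (auto simp: fan_def boundary_point_def of_nat_diff)

lemma fan_in_box:
  assumes "a > 0" "z \<in> rect n a"
  shows "fan n a z \<in> cbox (vector [- (real n + 2), 0]) (vector [real n + 2, real n + 2])"
proof -
  obtain x y where z: "z = (x, y)" by fastforce
  let ?r = "real n + 2 - x" and ?t = "pi * y / a"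
  have r: "0 \<le> ?r" "?r \<le> real n + 2" using assms z by (auto simp: rect_def)
  have t: "0 \<le> ?t" "?t \<le> pi" using assms z by (auto simp: rect_def field_simps)
  have "\<bar>?r * cos ?t\<bar> \<le> ?r" using r(1) by (simp add: abs_mult mult_left_le)
  moreover have "0 \<le> ?r * sin ?t" using r(1) t sin_ge_zero by simp
  moreover have "?r * sin ?t \<le> ?r" using r(1) by (simp add: mult_left_le)
  ultimately show ?thesis using r(2) by (simp add: z fan_def mem_box_cart forall_2 del: mult_minus_left) linarith
qed

text \<open>
  In the image under the fan map all four end points lie on the lower edge of a box, in interlaced
  order.
\<close>

lemma disjoint_arcs_do_not_interlace:
  assumes a: "a > 0" and S: "arc_between S (boundary_point n a x) (boundary_point n a x')" "S \<subseteq> rect n a"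
    and T: "arc_between T (boundary_point n a y) (boundary_point n a y')" "T \<subseteq> rect n a"
    and ord: "1 \<le> x" "x < y" "y < x'" "x' < y'" "y' \<le> 2 * n"
  shows "S \<inter> T \<noteq> {}"
proof -
  obtain g where g: "arc g" "path_image g = S" "pathstart g = boundary_point n a x" "pathfinish g = boundary_point n a x'"
    using S(1) unfolding arc_between_def by blast
  obtain h where h: "arc h" "path_image h = T" "pathstart h = boundary_point n a y" "pathfinish h = boundary_point n a y'"
    using T(1) unfolding arc_between_def by blast
  let ?g = "fan n a \<circ> g" and ?h = "fan n a \<circ> h"
  have mem: "x \<in> {1..2*n}" "y \<in> {1..2*n}" "x' \<in> {1..2*n}" "y' \<in> {1..2*n}" using ord by auto
  obtain z where z: "z \<in> path_image ?g" "z \<in> path_image ?h"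
  proof (rule fashoda_interlace[of ?g ?h "vector [- (real n + 2), 0]" "vector [real n + 2, real n + 2]"])
    show "path ?g" "path ?h"
      using g(1) h(1) arc_imp_path continuous_on_fan by (auto intro!: path_continuous_image)
    show "path_image ?g \<subseteq> cbox (vector [- (real n + 2), 0]) (vector [real n + 2, real n + 2])"
      using fan_in_box[OF a] S(2) g(2) by (auto simp: path_image_compose)
    show "path_image ?h \<subseteq> cbox (vector [- (real n + 2), 0]) (vector [real n + 2, real n + 2])"
      using fan_in_box[OF a] T(2) h(2) by (auto simp: path_image_compose)
  qed (use g h ord fan_boundary_point[OF a mem(1)] fan_boundary_point[OF a mem(2)]
         fan_boundary_point[OF a mem(3)] fan_boundary_point[OF a mem(4)]
       in \<open>auto simp: pathstart_compose pathfinish_compose split: if_splits\<close>)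
  then obtain u v where "u \<in> S" "v \<in> T" "fan n a u = z" "fan n a v = z"
    using g(2) h(2) by (auto simp: path_image_compose)
  then have "u = v" using inj_onD[OF inj_on_fan[OF a]] S(2) T(2) by blast
  then show ?thesis using \<open>u \<in> S\<close> \<open>v \<in> T\<close> by blast
qed

lemma realizes_imp_noncrossing:
  assumes "realizes n a D p k"
  shows "noncrossing n p"
  unfolding noncrossing_def
proof (intro ballI notI)
  have a: "a > 0" and D: "D \<subseteq> rect n a" and sys: "arc_system D {1..2 * n} p (boundary_point n a) k"
    using assms unfolding realizes_def by auto
  fix x y assume xy: "x \<in> {1..2 * n}" "y \<in> {1..2 * n}" "x < y \<and> y < p x \<and> p x < p y"
  show False
    using sys
  proof (rule arc_systemE)
    fix A and \<C> :: "(real \<times> real) set set"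
    assume *: "\<And>j. j \<in> {1..2 * n} \<Longrightarrow> p j \<in> {1..2 * n}"
      "\<And>j. j \<in> {1..2 * n} \<Longrightarrow> arc_between (A j) (boundary_point n a j) (boundary_point n a (p j))"
      "\<And>i j. i \<in> {1..2 * n} \<Longrightarrow> j \<in> {1..2 * n} \<Longrightarrow> j \<noteq> i \<Longrightarrow> j \<noteq> p i \<Longrightarrow> A i \<inter> A j = {}"
      "D = (\<Union>j\<in>{1..2 * n}. A j) \<union> \<Union>\<C>"
    have "A x \<inter> A y = {}" using *(3)[OF xy(1,2)] xy(3) by simp
    moreover have "A j \<subseteq> rect n a" if "j \<in> {1..2 * n}" for j
    proof -
      have "A j \<subseteq> D" unfolding *(4) using that by blast
      then show ?thesis using D by (rule subset_trans)
    qed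
    note this[OF xy(1)] this[OF xy(2)]
    ultimately show False
      using disjoint_arcs_do_not_interlace[OF a *(2)[OF xy(1)] _ *(2)[OF xy(2)]] xy *(1)[OF xy(2)] by auto
  qed
qed

section \<open>Composition with a generating diagram\<close>

lemma arc_between_image:
  fixes f :: "'a::topological_space \<Rightarrow> 'b::topological_space"
  assumes "arc_between S x y" "continuous_on S f" "inj_on f S"
  shows "arc_between (f ` S) (f x) (f y)"
proof -
  obtain g where g: "arc g" "path_image g = S" "pathstart g = x" "pathfinish g = y"
    using assms(1) unfolding arc_between_def by blast
  have "arc (f \<circ> g)"
    unfolding arc_def
  proof
    show "path (f \<circ> g)" using g assms(2) by (intro path_continuous_image arc_imp_path) auto
    show "inj_on (f \<circ> g) {0..1}"
      using g(1,2) assms(3) by (intro comp_inj_on) (auto simp: arc_def path_image_def)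
  qed
  then show ?thesis
    unfolding arc_between_def using g
    by (intro exI[of _ "f \<circ> g"]) (auto simp: path_image_compose pathstart_compose pathfinish_compose)
qed

lemma closed_curve_image:
  fixes f :: "'a::topological_space \<Rightarrow> 'b::topological_space"
  assumes "closed_curve S" "continuous_on S f" "inj_on f S"
  shows "closed_curve (f ` S)"
proof -
  obtain g where g: "simple_path g" "pathfinish g = pathstart g" "path_image g = S"
    using assms(1) unfolding closed_curve_def by blast
  have "simple_path (f \<circ> g)"
    unfolding simple_path_def
  proof
    show "path (f \<circ> g)" using g assms(2) by (intro path_continuous_image simple_path_imp_path) auto
    show "loop_free (f \<circ> g)"
      using g(1,3) assms(3) unfolding simple_path_def loop_free_def path_image_def inj_on_def
      by (metis comp_apply imageI)
  qed
  then show ?thesis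
    unfolding closed_curve_def using g
    by (intro exI[of _ "f \<circ> g"]) (auto simp: path_image_compose pathstart_compose pathfinish_compose)
qed

lemma arc_between_interval:
  fixes f :: "real \<Rightarrow> 'a::topological_space"
  assumes "u < v" "continuous_on {u..v} f" "inj_on f {u..v}"
  shows "arc_between (f ` {u..v}) (f u) (f v)"
proof -
  have "arc_between {u..v} u v"
    unfolding arc_between_def using assms(1)
    by (intro exI[of _ "linepath u v"]) (auto simp: arc_linepath closed_segment_eq_real_ivl)
  then show ?thesis using assms(2,3) by (rule arc_between_image)
qed

lemma mem_plane_sphere:
  fixes c b r x y :: real
  assumes "r > 0"
  shows "(x, y) \<in> sphere (c, b) r \<longleftrightarrow> (x - c)\<^sup>2 + (y - b)\<^sup>2 = r\<^sup>2"
proof -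
  have "(x, y) \<in> sphere (c, b) r \<longleftrightarrow> sqrt ((x - c)\<^sup>2 + (y - b)\<^sup>2) = r"
    by (simp add: dist_Pair_Pair dist_real_def power2_commute)
  also have "\<dots> \<longleftrightarrow> (x - c)\<^sup>2 + (y - b)\<^sup>2 = r\<^sup>2"
    using assms by (metis abs_of_pos real_sqrt_abs real_sqrt_eq_iff)
  finally show ?thesis .
qed

lemma plane_sphere_bounds:
  fixes c b r x y :: real
  assumes "r > 0" "(x, y) \<in> sphere (c, b) r"
  shows "c - r \<le> x" "x \<le> c + r" "b - r \<le> y" "y \<le> b + r" "y = b \<Longrightarrow> x = c - r \<or> x = c + r"
proof -
  have eq: "(x - c)\<^sup>2 + (y - b)\<^sup>2 = r\<^sup>2" using assms mem_plane_sphere by blast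
  then have "(x - c)\<^sup>2 \<le> r\<^sup>2" "(y - b)\<^sup>2 \<le> r\<^sup>2"
    using zero_le_power2[of "x - c"] zero_le_power2[of "y - b"] by linarith+
  then have "\<bar>x - c\<bar> \<le> r" "\<bar>y - b\<bar> \<le> r" using assms(1) by (simp_all add: abs_le_square_iff[symmetric])
  then show "c - r \<le> x" "x \<le> c + r" "b - r \<le> y" "y \<le> b + r" by linarith+
  show "x = c - r \<or> x = c + r" if "y = b"
  proof -
    have "(x - c)\<^sup>2 = r\<^sup>2" using eq that by simp
    then show ?thesis by (auto simp: power2_eq_iff)
  qed
qed

text \<open>
  The sign \<open>s\<close> selects the upper or the lower semicircle, a graph over its horizontal diameter.
\<close>

lemma arc_between_semicircle:
  fixes c b r s :: real
  assumes r: "r > 0" and s: "s\<^sup>2 = 1"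
  shows "arc_between {z \<in> sphere (c, b) r. 0 \<le> s * (snd z - b)} (c - r, b) (c + r, b)"
proof -
  let ?f = "\<lambda>t. (t, b + s * sqrt (r\<^sup>2 - (t - c)\<^sup>2))"
  have "arc_between (?f ` {c - r..c + r}) (?f (c - r)) (?f (c + r))"
    using r by (intro arc_between_interval) (auto intro!: continuous_intros inj_onI)
  moreover have "?f ` {c - r..c + r} = {z \<in> sphere (c, b) r. 0 \<le> s * (snd z - b)}"
  proof (intro equalityI subsetI)
    fix z assume "z \<in> ?f ` {c - r..c + r}"
    then obtain t where t: "t \<in> {c - r..c + r}" "z = ?f t" by blast
    have "(t - c)\<^sup>2 \<le> r\<^sup>2" using t(1) r by (intro power2_le_iff_abs_le[THEN iffD2]) (auto simp: abs_le_iff)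
    moreover have ss: "s * (s * w) = w" for w using s by (metis mult.assoc mult_1 power2_eq_square)
    ultimately show "z \<in> {z \<in> sphere (c, b) r. 0 \<le> s * (snd z - b)}"
      using r by (simp add: t(2) mem_plane_sphere power_mult_distrib s ss del: mem_sphere)
  next
    fix z assume z: "z \<in> {z \<in> sphere (c, b) r. 0 \<le> s * (snd z - b)}"
    obtain x y where xy: "z = (x, y)" by fastforce
    have eq: "(x - c)\<^sup>2 + (y - b)\<^sup>2 = r\<^sup>2" and sgn: "0 \<le> s * (y - b)"
      using z r by (simp_all add: xy mem_plane_sphere del: mem_sphere)
    have "(s * (y - b))\<^sup>2 = r\<^sup>2 - (x - c)\<^sup>2" using eq s by (simp add: power_mult_distrib)
    then have "sqrt (r\<^sup>2 - (x - c)\<^sup>2) = s * (y - b)" using sgn by (metis real_sqrt_unique)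
    moreover have ss: "s * (s * (y - b)) = y - b" using s by (metis mult.assoc mult_1 power2_eq_square)
    ultimately have "z = ?f x" by (simp only: xy ss) simp
    moreover have "x \<in> {c - r..c + r}" using plane_sphere_bounds(1,2)[OF r, of x y c b] z by (simp add: xy)
    ultimately show "z \<in> ?f ` {c - r..c + r}" by blast
  qed
  ultimately show ?thesis by simp
qed

lemma closed_curve_plane_sphere:
  fixes c :: "real \<times> real"
  assumes r: "r > 0" shows "closed_curve (sphere c r)"
proof -
  obtain x y where c: "c = (x, y)" by fastforce
  let ?S = "\<lambda>s. {z \<in> sphere (x, y) r. 0 \<le> s * (snd z - y)}"
  have "closed_curve (?S 1 \<union> ?S (- 1))"
  proof (rule closed_curve_Un)
    show "arc_between (?S 1) (x - r, y) (x + r, y)" by (rule arc_between_semicircle) (use r in auto)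
    have "arc_between (?S (- 1)) (x - r, y) (x + r, y)" by (rule arc_between_semicircle) (use r in auto)
    then show "arc_between (?S (- 1)) (x + r, y) (x - r, y)" by (rule arc_between_sym)
    show "?S 1 \<inter> ?S (- 1) \<subseteq> {(x - r, y), (x + r, y)}"
    proof
      fix z assume z: "z \<in> ?S 1 \<inter> ?S (- 1)"
      obtain u v where uv: "z = (u, v)" by fastforce
      have "v = y" "(u, v) \<in> sphere (x, y) r" using z by (auto simp: uv)
      then show "z \<in> {(x - r, y), (x + r, y)}" using plane_sphere_bounds(5)[OF r] uv by blast
    qed
  qed
  moreover have "?S 1 \<union> ?S (- 1) = sphere c r" unfolding c by auto
  ultimately show ?thesis by simp
qed

lemma arc_system_image:
  fixes f :: "'a::real_normed_vector \<Rightarrow> 'b::topological_space"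
  assumes D: "arc_system D J p q k" and f: "continuous_on D f" "inj_on f D"
  shows "arc_system (f ` D) J p (f \<circ> q) k"
proof -
  obtain A \<C> where *: "finite J" "finite \<C>" "card \<C> = k"
    "\<And>j. j \<in> J \<Longrightarrow> p j \<in> J" "\<And>j. j \<in> J \<Longrightarrow> p (p j) = j" "\<And>j. j \<in> J \<Longrightarrow> A (p j) = A j"
    "\<And>j. j \<in> J \<Longrightarrow> arc_between (A j) (q j) (q (p j))"
    "\<And>i j. i \<in> J \<Longrightarrow> j \<in> J \<Longrightarrow> j \<noteq> i \<Longrightarrow> j \<noteq> p i \<Longrightarrow> A i \<inter> A j = {}"
    "\<And>S. S \<in> \<C> \<Longrightarrow> closed_curve S" "pairwise disjnt \<C>"
    "\<And>j S. j \<in> J \<Longrightarrow> S \<in> \<C> \<Longrightarrow> A j \<inter> S = {}"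
    "D = (\<Union>j\<in>J. A j) \<union> \<Union>\<C>"
    by (rule arc_systemE[OF D]) (rule that, assumption+)
  have AD: "A l \<subseteq> D" if "l \<in> J" for l using *(12) that by auto
  have CD: "S \<subseteq> D" if "S \<in> \<C>" for S using *(12) that by auto
  have dj: "f ` S \<inter> f ` T = {}" if "S \<subseteq> D" "T \<subseteq> D" "S \<inter> T = {}" for S T
    using that f(2) by (metis image_empty inj_on_image_Int)
  have injC: "inj_on ((`) f) \<C>"
    using f(2) CD by (meson inj_on_image_eq_iff inj_onI)
  show ?thesis
  proof (rule arc_systemI[where A = "\<lambda>j. f ` A j" and \<C> = "(`) f ` \<C>"])
    show "card ((`) f ` \<C>) = k" using card_image[OF injC] *(3) by simp
    show "pairwise disjnt ((`) f ` \<C>)"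
      unfolding pairwise_def disjnt_def
    proof (intro ballI impI)
      fix S T assume "S \<in> (`) f ` \<C>" "T \<in> (`) f ` \<C>" and ne: "S \<noteq> T"
      then obtain S0 T0 where ST: "S0 \<in> \<C>" "T0 \<in> \<C>" "S = f ` S0" "T = f ` T0" by blast
      then have "S0 \<inter> T0 = {}" using *(10) ne unfolding pairwise_def disjnt_def by metis
      then show "S \<inter> T = {}" using dj[OF CD[OF ST(1)] CD[OF ST(2)]] ST(3,4) by simp
    qed
    show "f ` D = (\<Union>j\<in>J. f ` A j) \<union> \<Union>((`) f ` \<C>)"
      unfolding *(12) by auto
    show "closed_curve S" if S: "S \<in> (`) f ` \<C>" for S
    proof -
      obtain T where T: "T \<in> \<C>" "S = f ` T" using S by blast
      then show ?thesis
        using closed_curve_image[OF *(9)[OF T(1)]] continuous_on_subset[OF f(1) CD[OF T(1)]]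
          inj_on_subset[OF f(2) CD[OF T(1)]] by simp
    qed
    show "arc_between (f ` A j) ((f \<circ> q) j) ((f \<circ> q) (p j))" if "j \<in> J" for j
      using arc_between_image[OF *(7)[OF that] continuous_on_subset[OF f(1) AD[OF that]]
          inj_on_subset[OF f(2) AD[OF that]]] by simp
    show "f ` A i \<inter> f ` A j = {}" if "i \<in> J" "j \<in> J" "j \<noteq> i" "j \<noteq> p i" for i j
      using dj AD that *(8) by simp
    show "f ` A j \<inter> S = {}" if j: "j \<in> J" and S: "S \<in> (`) f ` \<C>" for j S
    proof -
      obtain T where T: "T \<in> \<C>" "S = f ` T" using S by blast
      then show ?thesis using dj[OF AD[OF j] CD[OF T(1)] *(11)[OF j T(1)]] by simp
    qed
  qed (use *(1,2,4,5,6) in auto)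
qed

definition vertical :: "nat \<Rightarrow> real \<Rightarrow> (real \<times> real) set" where
  "vertical j b = {real j} \<times> {0..b}"

lemma arc_between_vertical:
  assumes "b > 0" shows "arc_between (vertical j b) (real j, 0) (real j, b)"
proof -
  have "arc_between ((\<lambda>y. (real j, y)) ` {0..b}) (real j, 0) (real j, b)"
    using assms by (intro arc_between_interval) (auto intro!: continuous_intros inj_onI)
  moreover have "(\<lambda>y. (real j, y)) ` {0..b} = vertical j b" by (auto simp: vertical_def)
  ultimately show ?thesis by simp
qed

lemma unit_realizes: "realizes n 1 (unit_diagram n) (\<lambda>j. 2 * n + 1 - j) 0"
proof -
  define col where "col j = (if j \<le> n then j else 2 * n + 1 - j)" for j
  have un: "unit_diagram n = (\<Union>j\<in>{1..n}. vertical j 1)"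
    unfolding unit_diagram_def vertical_def by auto
  have colim: "col ` {1..2 * n} = {1..n}"
  proof
    show "{1..n} \<subseteq> col ` {1..2 * n}"
    proof
      fix j assume "j \<in> {1..n}"
      then have "j = col j" "j \<in> {1..2 * n}" by (auto simp: col_def)
      then show "j \<in> col ` {1..2 * n}" by blast
    qed
  qed (auto simp: col_def)
  have "arc_system (unit_diagram n) {1..2 * n} (\<lambda>j. 2 * n + 1 - j) (boundary_point n 1) 0"
  proof (rule arc_systemI[where A = "\<lambda>j. vertical (col j) 1" and \<C> = "{}"])
    show "unit_diagram n = (\<Union>j\<in>{1..2 * n}. vertical (col j) 1) \<union> \<Union>{}"
      unfolding un colim[symmetric] by simp
    show "arc_between (vertical (col j) 1) (boundary_point n 1 j) (boundary_point n 1 (2 * n + 1 - j))"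
      if j: "j \<in> {1..2 * n}" for j
    proof (cases "j \<le> n")
      case True
      then have "\<not> 2 * n + 1 - j \<le> n" "2 * n + 1 - (2 * n + 1 - j) = j" using j by auto
      then show ?thesis using True arc_between_vertical[of 1 j] by (simp add: col_def boundary_point_def)
    next
      case False
      then have "2 * n + 1 - j \<le> n" using j by auto
      then show ?thesis
        using False arc_between_sym[OF arc_between_vertical[of 1 "2 * n + 1 - j"]]
        by (simp add: col_def boundary_point_def)
    qed
    show "vertical (col i) 1 \<inter> vertical (col j) 1 = {}"
      if "i \<in> {1..2 * n}" "j \<in> {1..2 * n}" "j \<noteq> i" "j \<noteq> 2 * n + 1 - i" for i j
    proof -
      have "col i \<noteq> col j" using that by (auto simp: col_def split: if_splits)
      then show ?thesis by (auto simp: vertical_def)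
    qed
    show "vertical (col (2 * n + 1 - j)) 1 = vertical (col j) 1" if "j \<in> {1..2 * n}" for j
    proof -
      have "col (2 * n + 1 - j) = col j" using that by (auto simp: col_def)
      then show ?thesis by simp
    qed
  qed auto
  moreover have "unit_diagram n \<subseteq> rect n 1" unfolding unit_diagram_def rect_def by auto
  moreover have "unit_diagram n \<inter> ({0..real n + 1} \<times> {1}) = marked_points n 1"
    "unit_diagram n \<inter> ({0..real n + 1} \<times> {0}) = marked_points n 0"
    unfolding unit_diagram_def marked_points_def by auto
  ultimately show ?thesis unfolding realizes_def by simp
qed

definition lift_up :: "real \<Rightarrow> (real \<times> real) set \<Rightarrow> (real \<times> real) set" where
  "lift_up b D = (\<lambda>z. z + (0, b)) ` D"

lemma diagram_comp_lift_up: "diagram_comp b D2 D1 = lift_up b D1 \<union> D2"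
  unfolding diagram_comp_def lift_up_def by force

lemma lift_up_realized:
  assumes "realizes n a D p k" and b: "b > 0"
  shows "arc_system (lift_up b D) {1..2 * n} p (\<lambda>j. if j \<le> n then (real j, b) else boundary_point n (a + b) j) k"
    and "\<And>x y. (x, y) \<in> lift_up b D \<Longrightarrow> 0 \<le> x \<and> x \<le> real n + 1 \<and> b \<le> y \<and> y \<le> a + b"
    and "\<And>x. (x, b) \<in> lift_up b D \<longleftrightarrow> (\<exists>j\<in>{1..n}. x = real j)"
    and "\<And>x. (x, a + b) \<in> lift_up b D \<longleftrightarrow> (\<exists>j\<in>{1..n}. x = real j)"
proof -
  have a: "a > 0" and D: "D \<subseteq> rect n a" and sys: "arc_system D {1..2 * n} p (boundary_point n a) k"
    and top: "D \<inter> ({0..real n + 1} \<times> {a}) = marked_points n a"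
    and bot: "D \<inter> ({0..real n + 1} \<times> {0}) = marked_points n 0"
    using assms(1) unfolding realizes_def by blast+
  have mem: "(x, y) \<in> lift_up b D \<longleftrightarrow> (x, y - b) \<in> D" for x y
    unfolding lift_up_def by (force simp: image_iff)
  have "arc_system (lift_up b D) {1..2 * n} p ((\<lambda>z. z + (0, b)) \<circ> boundary_point n a) k"
    unfolding lift_up_def using sys
    by (rule arc_system_image) (auto intro!: continuous_intros inj_onI)
  then show "arc_system (lift_up b D) {1..2 * n} p (\<lambda>j. if j \<le> n then (real j, b) else boundary_point n (a + b) j) k"
    by (rule arc_system_cong) (auto simp: boundary_point_def)
  show "0 \<le> x \<and> x \<le> real n + 1 \<and> b \<le> y \<and> y \<le> a + b" if "(x, y) \<in> lift_up b D" for x y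
    using that D unfolding mem rect_def by auto
  show "(x, b) \<in> lift_up b D \<longleftrightarrow> (\<exists>j\<in>{1..n}. x = real j)" for x
  proof -
    have "(x, 0) \<in> D \<longleftrightarrow> (x, 0) \<in> marked_points n 0"
      using D unfolding bot[symmetric] rect_def by auto
    then show ?thesis unfolding mem by (auto simp: marked_points_def)
  qed
  show "(x, a + b) \<in> lift_up b D \<longleftrightarrow> (\<exists>j\<in>{1..n}. x = real j)" for x
  proof -
    have "(x, a) \<in> D \<longleftrightarrow> (x, a) \<in> marked_points n a"
      using D unfolding top[symmetric] rect_def by auto
    then show ?thesis unfolding mem by (auto simp: marked_points_def)
  qed
qed

text \<open>
  The first stage of a composition. The verticals of the lower diagram only lengthen threads of the
  upper one.
\<close>

lemma attach_verticals:
  assumes E: "realizes n a D p k" and b: "b > 0" and L: "L \<subseteq> {1..n}"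
  shows "arc_system (lift_up b D \<union> (\<Union>l\<in>L. vertical l b)) {1..2 * n} p
    (\<lambda>j. if j \<in> L then (real j, 0) else if j \<le> n then (real j, b) else boundary_point n (a + b) j) k"
proof -
  note up = lift_up_realized[OF E b]
  have "finite L" using L finite_subset by blast
  then show ?thesis using L
  proof (induction L rule: finite_induct)
    case empty
    then show ?case using up(1) by simp
  next
    case (insert l L)
    let ?X = "lift_up b D \<union> (\<Union>l\<in>L. vertical l b)"
    let ?q = "\<lambda>j. if j \<in> L then (real j, 0) else if j \<le> n then (real j, b) else boundary_point n (a + b) j"
    have l: "l \<in> {1..n}" using insert.prems by simp
    have sys: "arc_system ?X {1..2 * n} p ?q k" using insert by simp
    have ql: "?q l = (real l, b)" using l insert.hyps(2) by simp
    have trace: "vertical l b \<inter> ?X = {?q l}"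
    proof -
      have "(real l, b) \<in> lift_up b D" using up(3) l by blast
      moreover have "vertical l b \<inter> vertical m b = {}" if "m \<in> L" for m
        using that insert.hyps(2) by (auto simp: vertical_def)
      moreover have "vertical l b \<inter> lift_up b D \<subseteq> {(real l, b)}"
        using up(2) by (fastforce simp: vertical_def)
      moreover have "(real l, b) \<in> vertical l b" using b by (simp add: vertical_def)
      ultimately show ?thesis unfolding ql by blast
    qed
    have arc: "arc_between (vertical l b) (real l, 0) (?q l)" unfolding ql by (rule arc_between_vertical[OF b])
    have lJ: "l \<in> {1..2 * n}" using l by simp
    have "arc_system (?X \<union> vertical l b) {1..2 * n} p (?q(l := (real l, 0))) k"
      by (rule arc_system_extend[OF sys arc trace lJ])
    then have "arc_system (?X \<union> vertical l b) {1..2 * n} p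
       (\<lambda>j. if j \<in> insert l L then (real j, 0) else if j \<le> n then (real j, b) else boundary_point n (a + b) j) k"
      by (rule arc_system_cong) auto
    moreover have "?X \<union> vertical l b = lift_up b D \<union> (\<Union>l\<in>insert l L. vertical l b)" by auto
    ultimately show ?case by simp
  qed
qed

lemma trace_on_edge:
  assumes "\<And>x. (x, y) \<in> D \<longleftrightarrow> (\<exists>j\<in>{1..n}. x = real j)"
  shows "D \<inter> ({0..real n + 1} \<times> {y}) = marked_points n y"
  using assms unfolding marked_points_def by fastforce

lemma circular_comp_realizes:
  assumes E: "realizes n a D p k"
  shows "realizes n (a + 1) (diagram_comp 1 (circular_diagram n) D) p (Suc k)"
proof -
  note up = lift_up_realized[OF E zero_less_one]
  have a: "a > 0" using E unfolding realizes_def by simp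
  let ?X = "lift_up 1 D \<union> (\<Union>l\<in>{1..n}. vertical l 1)" and ?S = "sphere (1/2, 1/2) (1/4) :: (real \<times> real) set"
  have un: "unit_diagram n = (\<Union>j\<in>{1..n}. vertical j 1)"
    unfolding unit_diagram_def vertical_def by auto
  have eq: "diagram_comp 1 (circular_diagram n) D = ?X \<union> ?S"
    unfolding diagram_comp_lift_up circular_diagram_def un by auto
  have S: "1/4 \<le> x \<and> x \<le> 3/4 \<and> 1/4 \<le> y \<and> y \<le> 3/4" if "(x, y) \<in> ?S" for x y
  proof -
    from plane_sphere_bounds(1-4)[OF _ that] show ?thesis by simp
  qed
  have "arc_system ?X {1..2 * n} p (boundary_point n (a + 1)) k"
    using attach_verticals[OF E zero_less_one order_refl] by (rule arc_system_cong) (auto simp: boundary_point_def)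
  moreover have "?S \<inter> ?X = {}"
  proof -
    have "(x, y) \<notin> ?X" if "(x, y) \<in> ?S" for x y
      using S[OF that] up(2)[of x y] by (auto simp: vertical_def)
    then show ?thesis by force
  qed
  ultimately have "arc_system (?X \<union> ?S) {1..2 * n} p (boundary_point n (a + 1)) (Suc k)"
    by (intro arc_system_add_closed_curve closed_curve_plane_sphere) auto
  moreover have "?X \<union> ?S \<subseteq> rect n (a + 1)"
  proof -
    have "(x, y) \<in> rect n (a + 1)" if "(x, y) \<in> ?X \<union> ?S" for x y
      using that up(2)[of x y] S[of x y] a by (auto simp: vertical_def rect_def)
    then show ?thesis by force
  qed
  moreover have "(?X \<union> ?S) \<inter> ({0..real n + 1} \<times> {a + 1}) = marked_points n (a + 1)"
  proof -
    have "(x, a + 1) \<in> ?X \<union> ?S \<longleftrightarrow> (\<exists>j\<in>{1..n}. x = real j)" for x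
      using up(4)[of x] S[of x "a + 1"] a by (auto simp: vertical_def)
    then show ?thesis unfolding marked_points_def by fastforce
  qed
  moreover have "(?X \<union> ?S) \<inter> ({0..real n + 1} \<times> {0}) = marked_points n 0"
  proof -
    have "(x, 0) \<in> ?X \<union> ?S \<longleftrightarrow> (\<exists>j\<in>{1..n}. x = real j)" for x
      using up(2)[of x 0] S[of x 0] by (auto simp: vertical_def)
    then show ?thesis unfolding marked_points_def by fastforce
  qed
  ultimately show ?thesis unfolding realizes_def eq using a by simp
qed

text \<open>
  The effect of \<open>H\<^sup>i\<close> below a diagram: its cup joins the ends \<open>i\<close> and \<open>i + 1\<close>, so their partners become
  partners of each other, and its cap provides a new thread between \<open>i\<close> and \<open>i + 1\<close>. If the two ends
  were partners already, the cup closes their thread to a circle.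
\<close>

definition surgery :: "nat \<Rightarrow> (nat \<Rightarrow> nat) \<Rightarrow> nat \<Rightarrow> nat" where
  "surgery i p =
     (if p i = i + 1 then p else p(p i := p (i + 1), p (i + 1) := p i))(i := i + 1, i + 1 := i)"

text \<open>
  The pieces of \<open>H\<^sup>i\<close> are attached one by one: first the verticals, then the cup \<open>?S\<close>, which joins or
  closes threads, and at last the cap \<open>?Q\<close>, which stays below the cup because the height of \<open>H\<^sup>i\<close>
  exceeds the sum of the two radii.
\<close>

lemma diapsidal_comp_realizes:
  assumes E: "realizes n a D p k" and i: "1 \<le> i" "i + 1 \<le> n"
  shows "realizes n (a + diapsidal_height n) (diagram_comp (diapsidal_height n) (diapsidal_diagram n i) D)
    (surgery i p) (if p i = i + 1 then Suc k else k)"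
proof -
  define b where "b = diapsidal_height n"
  have b5: "b \<ge> 5" unfolding b_def diapsidal_height_def by simp
  then have b: "b > 0" by simp
  have a: "a > 0" using E unfolding realizes_def by simp
  note up = lift_up_realized[OF E b]
  let ?L = "{1..n} - {i, i + 1}" and ?J = "{1..2 * n}"
  let ?c = "real i + 1/2"
  let ?X = "lift_up b D \<union> (\<Union>l\<in>?L. vertical l b)"
  let ?q = "\<lambda>j. if j \<in> ?L then (real j, 0) else if j \<le> n then (real j, b) else boundary_point n (a + b) j"
  let ?S = "{z \<in> sphere (?c, b) (1/2). snd z \<le> b}" and ?Q = "{z \<in> sphere (?c, 0) (1/2). snd z \<ge> (0::real)}"
  have sys: "arc_system ?X ?J p ?q k" by (rule attach_verticals[OF E b]) blast
  have iN: "i \<in> {1..n}" "i + 1 \<in> {1..n}" using i by simp_all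
  have half: "(0::real) < 1/2" by simp
  have ends: "?c - 1/2 = real i" "?c + 1/2 = real (i + 1)" by simp_all
  have arcS: "arc_between ?S (?q i) (?q (i + 1))"
    using arc_between_semicircle[of "1/2" "- 1" ?c b] i unfolding ends by simp
  have arcQ: "arc_between ?Q (real i, 0) (real (i + 1), 0)"
    using arc_between_semicircle[of "1/2" 1 ?c 0] unfolding ends by simp
  have Sb: "real i \<le> x \<and> x \<le> real (i + 1) \<and> b - 1/2 \<le> y \<and> y \<le> b \<and> (y = b \<longrightarrow> x = real i \<or> x = real (i + 1))"
    if "(x, y) \<in> ?S" for x y
  proof -
    have xy: "(x, y) \<in> sphere (?c, b) (1/2)" "y \<le> b" using that by simp_all
    show ?thesis using plane_sphere_bounds[OF half xy(1), unfolded ends] xy(2) by blast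
  qed
  have Qb: "real i \<le> x \<and> x \<le> real (i + 1) \<and> 0 \<le> y \<and> y \<le> 1/2 \<and> (y = 0 \<longrightarrow> x = real i \<or> x = real (i + 1))"
    if "(x, y) \<in> ?Q" for x y
  proof -
    have xy: "(x, y) \<in> sphere (?c, 0) (1/2)" "0 \<le> y" using that by simp_all
    show ?thesis using plane_sphere_bounds[OF half xy(1), unfolded ends] xy(2) by simp
  qed
  have Vb: "x = real l \<and> 0 \<le> y \<and> y \<le> b" if "(x, y) \<in> vertical l b" for x y l
    using that by (simp add: vertical_def)
  have off: "\<not> (real i \<le> real l \<and> real l \<le> real (i + 1))" if "l \<in> ?L" for l
    using that unfolding of_nat_le_iff by auto
  have qi: "?q i = (real i, b)" "?q (i + 1) = (real (i + 1), b)" using i by simp_all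
  have traceS: "?S \<inter> ?X = {?q i, ?q (i + 1)}"
  proof
    have inX: "(real j, b) \<in> ?X" if "j \<in> {1..n}" for j using up(3) that by blast
    have "?q i \<in> ?X" unfolding qi by (rule inX[OF iN(1)])
    moreover have "?q (i + 1) \<in> ?X" unfolding qi by (rule inX[OF iN(2)])
    ultimately show "{?q i, ?q (i + 1)} \<subseteq> ?S \<inter> ?X" using arc_between_ends(1,2)[OF arcS] by blast
    show "?S \<inter> ?X \<subseteq> {?q i, ?q (i + 1)}"
    proof
      fix z assume z: "z \<in> ?S \<inter> ?X"
      obtain x y where xy: "z = (x, y)" by fastforce
      have S: "(x, y) \<in> ?S" and X: "(x, y) \<in> ?X" using z unfolding xy by blast+
      have "(x, y) \<notin> vertical l b" if "l \<in> ?L" for l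
        using Sb[OF S] Vb[of x y l] off[OF that] by auto
      then have "(x, y) \<in> lift_up b D" using X by blast
      then have "y = b" using up(2)[of x y] Sb[OF S] by linarith
      then show "z \<in> {?q i, ?q (i + 1)}" unfolding qi xy using Sb[OF S] by auto
    qed
  qed
  have iJ: "i \<in> ?J" "i + 1 \<in> ?J" using i by auto
  define p1 where "p1 = (if p i = i + 1 then p else p(p i := p (i + 1), p (i + 1) := p i))"
  define k1 where "k1 = (if p i = i + 1 then Suc k else k)"
  have sys1: "arc_system (?X \<union> ?S) (?J - {i, i + 1}) p1 ?q k1"
  proof (cases "p i = i + 1")
    case True
    then show ?thesis
      using arc_system_close[OF sys arcS traceS iJ(1) True] by (simp add: p1_def k1_def)
  next
    case False
    then show ?thesis
      using arc_system_join[OF sys arcS traceS iJ _ False] by (simp add: p1_def k1_def)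
  qed
  have "?Q \<inter> (?X \<union> ?S) = {}"
  proof -
    have "(x, y) \<notin> ?X \<union> ?S" if Q: "(x, y) \<in> ?Q" for x y
    proof -
      have "(x, y) \<notin> vertical l b" if "l \<in> ?L" for l
        using Qb[OF Q] Vb[of x y l] off[OF that] by auto
      moreover have "(x, y) \<notin> lift_up b D" using up(2)[of x y] Qb[OF Q] b5 by auto
      moreover have "(x, y) \<notin> ?S" using Sb[of x y] Qb[OF Q] b5 by linarith
      ultimately show ?thesis by blast
    qed
    then show ?thesis by fast
  qed
  then have "arc_system (?X \<union> ?S \<union> ?Q) (insert i (insert (i + 1) (?J - {i, i + 1})))
     (p1(i := i + 1, i + 1 := i)) (?q(i := (real i, 0), i + 1 := (real (i + 1), 0))) k1"
    by (intro arc_system_add_arc[OF sys1 arcQ]) auto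
  moreover have "insert i (insert (i + 1) (?J - {i, i + 1})) = ?J" using iJ by auto
  moreover have "p1(i := i + 1, i + 1 := i) = surgery i p" unfolding surgery_def p1_def ..
  ultimately have "arc_system (?X \<union> ?S \<union> ?Q) ?J (surgery i p)
      (?q(i := (real i, 0), i + 1 := (real (i + 1), 0))) k1" by simp
  then have final: "arc_system (?X \<union> ?S \<union> ?Q) ?J (surgery i p) (boundary_point n (a + b)) k1"
    by (rule arc_system_cong) (use i in \<open>auto simp: boundary_point_def\<close>)
  have eq: "diagram_comp b (diapsidal_diagram n i) D = ?X \<union> ?S \<union> ?Q"
  proof -
    have "{(real j, y) |j y. j \<in> ?L \<and> y \<in> {0..b}} = (\<Union>l\<in>?L. vertical l b)"
      unfolding vertical_def by auto
    then have "diapsidal_diagram n i = ?S \<union> ?Q \<union> (\<Union>l\<in>?L. vertical l b)"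
      unfolding diapsidal_diagram_def b_def[symmetric] by simp
    then show ?thesis unfolding diagram_comp_lift_up by (simp only: Un_ac)
  qed
  have i': "0 \<le> real i" "real (i + 1) \<le> real n + 1" using i by auto
  have mem: "(x, y) \<in> ?X \<union> ?S \<union> ?Q \<longleftrightarrow>
    (x, y) \<in> lift_up b D \<or> (\<exists>l\<in>?L. (x, y) \<in> vertical l b) \<or> (x, y) \<in> ?S \<or> (x, y) \<in> ?Q" for x y
    by blast
  have sub: "?X \<union> ?S \<union> ?Q \<subseteq> rect n (a + b)"
  proof (rule subrelI)
    fix x y assume xy: "(x, y) \<in> ?X \<union> ?S \<union> ?Q"
    have "0 \<le> x \<and> x \<le> real n + 1 \<and> 0 \<le> y \<and> y \<le> a + b"
    proof -
      from xy[unfolded mem] consider "(x, y) \<in> lift_up b D" | l where "l \<in> ?L" "(x, y) \<in> vertical l b"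
        | "(x, y) \<in> ?S" | "(x, y) \<in> ?Q" by blast
      then show ?thesis
      proof cases
        case 1 then show ?thesis using up(2) a b by fastforce
      next
        case 2 then show ?thesis using Vb a b by fastforce
      next
        case 3 show ?thesis using Sb[OF 3] a b5 i' by linarith
      next
        case 4 show ?thesis using Qb[OF 4] a b5 i' by linarith
      qed
    qed
    then show "(x, y) \<in> rect n (a + b)"
      unfolding rect_def mem_Times_iff fst_conv snd_conv atLeastAtMost_iff by blast
  qed
  have top: "(x, a + b) \<in> ?X \<union> ?S \<union> ?Q \<longleftrightarrow> (\<exists>j\<in>{1..n}. x = real j)" for x
  proof -
    have "(x, a + b) \<notin> ?S" using Sb[of x "a + b"] a by linarith
    moreover have "(x, a + b) \<notin> ?Q" using Qb[of x "a + b"] a b5 by linarith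
    moreover have "(x, a + b) \<notin> vertical l b" for l using Vb[of x "a + b" l] a by linarith
    ultimately show ?thesis unfolding mem using up(4)[of x] by blast
  qed
  have bot: "(x, 0) \<in> ?X \<union> ?S \<union> ?Q \<longleftrightarrow> (\<exists>j\<in>{1..n}. x = real j)" for x
  proof
    assume "(x, 0) \<in> ?X \<union> ?S \<union> ?Q"
    then have "(\<exists>l\<in>?L. (x, 0) \<in> vertical l b) \<or> (x, 0) \<in> ?Q"
      unfolding mem using up(2)[of x 0] Sb[of x 0] b5 by auto
    then show "\<exists>j\<in>{1..n}. x = real j"
    proof
      assume "(x, 0) \<in> ?Q"
      then have "x = real i \<or> x = real (i + 1)" using Qb by blast
      then show ?thesis using iN by blast
    qed (use Vb in blast)
  next
    assume "\<exists>j\<in>{1..n}. x = real j"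
    then obtain j where j: "j \<in> {1..n}" "x = real j" by blast
    show "(x, 0) \<in> ?X \<union> ?S \<union> ?Q"
    proof (cases "j \<in> ?L")
      case True
      moreover have "(x, 0) \<in> vertical j b" using j(2) b by (simp add: vertical_def)
      ultimately show ?thesis unfolding mem by blast
    next
      case False
      then have "j = i \<or> j = i + 1" using j(1) by blast
      then have "(x, 0) \<in> ?Q" using arc_between_ends(1,2)[OF arcQ] j(2) by metis
      then show ?thesis by blast
    qed
  qed
  have "(?X \<union> ?S \<union> ?Q) \<inter> ({0..real n + 1} \<times> {a + b}) = marked_points n (a + b)"
    by (rule trace_on_edge[OF top])
  moreover have "(?X \<union> ?S \<union> ?Q) \<inter> ({0..real n + 1} \<times> {0}) = marked_points n 0"
    by (rule trace_on_edge[OF bot])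
  ultimately show ?thesis
    unfolding b_def[symmetric] eq realizes_def k1_def[symmetric] using final sub a b by simp
qed

section \<open>Every noncrossing matching is generated\<close>

definition matching :: "nat \<Rightarrow> (nat \<Rightarrow> nat) \<Rightarrow> bool" where
  "matching n p \<longleftrightarrow> (\<forall>j\<in>{1..2 * n}. p j \<in> {1..2 * n} \<and> p j \<noteq> j \<and> p (p j) = j)"

lemma matchingD:
  assumes "matching n p" "1 \<le> j" "j \<le> 2 * n"
  shows "1 \<le> p j" "p j \<le> 2 * n" "p j \<noteq> j" "p (p j) = j"
  using assms unfolding matching_def by auto

lemma noncrossingD:
  "noncrossing n p \<Longrightarrow> 1 \<le> x \<Longrightarrow> x < y \<Longrightarrow> y < p x \<Longrightarrow> p x < p y \<Longrightarrow> y \<le> 2 * n \<Longrightarrow> False"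
  unfolding noncrossing_def by auto

lemma realizes_imp_matching:
  assumes "realizes n a D p k" shows "matching n p"
proof -
  have sys: "arc_system D {1..2 * n} p (boundary_point n a) k" using assms unfolding realizes_def by blast
  show ?thesis
    using sys
  proof (rule arc_systemE)
    fix A and \<C> :: "(real \<times> real) set set"
    assume *: "\<And>j. j \<in> {1..2 * n} \<Longrightarrow> p j \<in> {1..2 * n}" "\<And>j. j \<in> {1..2 * n} \<Longrightarrow> p (p j) = j"
      "\<And>j. j \<in> {1..2 * n} \<Longrightarrow> arc_between (A j) (boundary_point n a j) (boundary_point n a (p j))"
    have "p j \<noteq> j" if "j \<in> {1..2 * n}" for j using arc_between_ends(3)[OF *(3)[OF that]] by auto
    then show ?thesis unfolding matching_def using * by blast
  qed
qed

lemma realizes_cong: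
  assumes "realizes n a D p k" "\<And>j. 1 \<le> j \<Longrightarrow> j \<le> 2 * n \<Longrightarrow> p' j = p j"
  shows "realizes n a D p' k"
  using assms arc_system_cong[of D "{1..2 * n}" p "boundary_point n a" k p' "boundary_point n a"]
  unfolding realizes_def by auto

definition generable :: "nat \<Rightarrow> (nat \<Rightarrow> nat) \<Rightarrow> bool" where
  "generable n p \<longleftrightarrow> (\<exists>b E. generated n b E \<and> realizes n b E p 0)"

lemma generable_cong:
  assumes "generable n p" "\<And>j. 1 \<le> j \<Longrightarrow> j \<le> 2 * n \<Longrightarrow> p' j = p j"
  shows "generable n p'"
  using assms realizes_cong unfolding generable_def by meson

lemma generable_vertical:
  assumes "\<And>j. 1 \<le> j \<Longrightarrow> j \<le> 2 * n \<Longrightarrow> p j = 2 * n + 1 - j"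
  shows "generable n p"
proof -
  have "generable n (\<lambda>j. 2 * n + 1 - j)"
    unfolding generable_def using generated.unit unit_realizes by blast
  then show ?thesis using generable_cong assms by blast
qed

lemma generable_surgery:
  assumes "generable n p" "1 \<le> i" "i + 1 \<le> n" "p i \<noteq> i + 1"
  shows "generable n (surgery i p)"
proof -
  obtain b E where E: "generated n b E" "realizes n b E p 0" using assms(1) unfolding generable_def by blast
  have "realizes n (b + diapsidal_height n) (diagram_comp (diapsidal_height n) (diapsidal_diagram n i) E) (surgery i p) 0"
    using diapsidal_comp_realizes[OF E(2) assms(2,3)] assms(4) by simp
  moreover have "generated n (b + diapsidal_height n) (diagram_comp (diapsidal_height n) (diapsidal_diagram n i) E)"
    using E(1) generated.diapsidal[OF assms(2,3)] by (rule generated.comp)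
  ultimately show ?thesis unfolding generable_def by blast
qed

lemma add_circles:
  assumes "generated n b E" "realizes n b E p 0"
  shows "\<exists>b E. generated n b E \<and> realizes n b E p k"
proof (induction k)
  case 0
  then show ?case using assms by blast
next
  case (Suc k)
  then obtain b E where E: "generated n b E" "realizes n b E p k" by blast
  have "generated n (b + 1) (diagram_comp 1 (circular_diagram n) E)"
    using E(1) generated.circular by (rule generated.comp)
  then show ?case using circular_comp_realizes[OF E(2)] by blast
qed

text \<open>
  Surgery at \<open>i + 1\<close> moves the cap from \<open>i\<close>, \<open>i + 1\<close> to \<open>i + 1\<close>, \<open>i + 2\<close>, and \<open>i\<close> inherits the partner of
  \<open>i + 2\<close>. Apart from the cap this is an order preserving relabelling, so no crossing arises. That
  surgery at \<open>i\<close> undoes the change is the relation \<open>e\<^sub>i e\<^sub>i\<^sub>+\<^sub>1 e\<^sub>i = e\<^sub>i\<close> of the Temperley-Lieb algebra.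
\<close>

lemma move_cap:
  assumes p: "matching n p" "noncrossing n p" and i: "1 \<le> i" "i + 2 \<le> n" "p i = i + 1"
  defines "p' \<equiv> surgery (i + 1) p"
  shows "matching n p'" "noncrossing n p'" "p' (i + 1) = i + 2" "p' i = p (i + 2)"
    "\<And>j. j \<notin> {i, i + 1, i + 2, p (i + 2)} \<Longrightarrow> p' j = p j"
    "\<And>j. 1 \<le> j \<Longrightarrow> j \<le> 2 * n \<Longrightarrow> surgery i p' j = p j"
proof -
  define z where "z = p (i + 2)"
  have pi1: "p (i + 1) = i" using matchingD(4)[OF p(1), of i] i by simp
  have z: "1 \<le> z" "z \<le> 2 * n" "z \<noteq> i + 2" "p z = i + 2"
    using matchingD[OF p(1), of "i + 2"] i unfolding z_def by auto
  have zi: "z \<noteq> i" "z \<noteq> i + 1" using z(4) i(3) pi1 by auto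
  have p': "p' j = (if j = i then z else if j = z then i else if j = i + 1 then i + 2 else if j = i + 2 then i + 1 else p j)" for j
    unfolding p'_def surgery_def using pi1 z zi by (auto simp: z_def)
  have out: "p j \<notin> {i, i + 1, i + 2, z}" if "1 \<le> j" "j \<le> 2 * n" "j \<notin> {i, i + 1, i + 2, z}" for j
  proof
    assume "p j \<in> {i, i + 1, i + 2, z}"
    then have "p (p j) \<in> {i + 1, i, z, i + 2}" using i(3) pi1 z(4) z_def by auto
    then show False using matchingD(4)[OF p(1) that(1,2)] that(3) by auto
  qed
  show "matching n p'"
    unfolding matching_def
  proof
    fix j assume j: "j \<in> {1..2 * n}"
    show "p' j \<in> {1..2 * n} \<and> p' j \<noteq> j \<and> p' (p' j) = j"
    proof (cases "j \<in> {i, i + 1, i + 2, z}")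
      case True
      then show ?thesis using z zi i by (auto simp: p')
    next
      case False
      then have "p' j = p j" "p' (p j) = p (p j)" using out[of j] j by (auto simp: p')
      then show ?thesis using matchingD[OF p(1), of j] j by auto
    qed
  qed
  show "noncrossing n p'"
    unfolding noncrossing_def
  proof (intro ballI notI)
    fix x y assume xy: "x \<in> {1..2 * n}" "y \<in> {1..2 * n}" "x < y \<and> y < p' x \<and> p' x < p' y"
    \<comment> \<open>\<open>\<tau>\<close> undoes the relabelling, so the crossing would have been there before.\<close>
    define \<tau> where "\<tau> w = (if w = i then i + 2 else w)" for w
    have v: "p' (i + 1) = i + 2" "p' (i + 2) = i + 1" using z(3) zi by (simp_all add: p')
    have nx: "x \<noteq> i + 1" "x \<noteq> i + 2" and ny: "y \<noteq> i + 2"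
      using xy(3) v by (intro notI; simp)+
    have ny1: "y \<noteq> i + 1"
    proof
      assume "y = i + 1"
      then have "i + 1 < p' x" "p' x < i + 2" using xy(3) v(1) by auto
      then show False by simp
    qed
    have \<tau>p: "p (\<tau> w) = \<tau> (p' w)" "p' w \<noteq> i + 1" "p' w \<noteq> i + 2"
      if "w \<in> {1..2 * n}" "w \<noteq> i + 1" "w \<noteq> i + 2" for w
      
    proof -
      have "p (\<tau> w) = \<tau> (p' w) \<and> p' w \<noteq> i + 1 \<and> p' w \<noteq> i + 2"
      proof (cases "w = i \<or> w = z")
        case True
        then show ?thesis using that z(3,4) zi z_def by (auto simp: \<tau>_def p')
      next
        case False
        then show ?thesis using out[of w] that by (simp add: \<tau>_def p')
      qed
      then show "p (\<tau> w) = \<tau> (p' w)" "p' w \<noteq> i + 1" "p' w \<noteq> i + 2" by blast+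
    qed
    have mono: "\<tau> v < \<tau> w" if "v < w" "v \<noteq> i + 1" "w \<noteq> i + 1" "v \<noteq> i + 2" "w \<noteq> i + 2" for v w
      using that by (auto simp: \<tau>_def)
    note X = \<tau>p[OF xy(1) nx] and Y = \<tau>p[OF xy(2) ny1 ny]
    have "\<tau> x < \<tau> y" using xy(3) nx ny ny1 by (intro mono) auto
    moreover have "\<tau> y < p (\<tau> x)" unfolding X(1) using xy(3) X(2,3) ny ny1 by (intro mono) auto
    moreover have "p (\<tau> x) < p (\<tau> y)" unfolding X(1) Y(1) using xy(3) X(2,3) Y(2,3) by (intro mono) auto
    moreover have "1 \<le> \<tau> x" "\<tau> y \<le> 2 * n" using xy(1,2) i by (auto simp: \<tau>_def)
    ultimately show False using noncrossingD[OF p(2)] by blast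
  qed
  show "p' (i + 1) = i + 2" "p' i = p (i + 2)" using zi by (auto simp: p' z_def)
  show "p' j = p j" if "j \<notin> {i, i + 1, i + 2, p (i + 2)}" for j using that by (auto simp: p' z_def)
  show "surgery i p' j = p j" if "1 \<le> j" "j \<le> 2 * n" for j
    using z zi i(3) pi1 unfolding surgery_def by (auto simp: p' z_def)
qed

text \<open>
  The cap at \<open>m - 1\<close>, \<open>m\<close> and the thread that ends in \<open>T\<close>, the top point above \<open>m\<close>, are replaced by a
  vertical strand from \<open>m\<close> to \<open>T\<close> and a thread from \<open>m - 1\<close> to the old partner of \<open>T\<close>. Surgery at
  \<open>m - 1\<close> restores the old matching. The points between \<open>m\<close> and \<open>T\<close> are matched among
  themselves, so any crossing of a new thread would come from a crossing with the old thread at \<open>T\<close>.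
\<close>

lemma straighten_strand:
  assumes p: "matching n p" "noncrossing n p" and m: "2 \<le> m" "m \<le> n" "p (m - 1) = m"
    and vert: "\<And>j. m < j \<Longrightarrow> j \<le> n \<Longrightarrow> p j = 2 * n + 1 - j"
  defines "T \<equiv> 2 * n + 1 - m"
  defines "p' \<equiv> p(m := T, T := m, m - 1 := p T, p T := m - 1)"
  shows "matching n p'" "noncrossing n p'" "\<And>j. m \<le> j \<Longrightarrow> j \<le> n \<Longrightarrow> p' j = 2 * n + 1 - j"
    "p' (m - 1) \<noteq> m" "\<And>j. 1 \<le> j \<Longrightarrow> j \<le> 2 * n \<Longrightarrow> surgery (m - 1) p' j = p j"
proof -
  define z where "z = p T"
  have T: "n < T" "T \<le> 2 * n" "1 \<le> T" using m unfolding T_def by auto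
  have pm: "p m = m - 1" using matchingD(4)[OF p(1), of "m - 1"] m by simp
  have z: "1 \<le> z" "z \<le> 2 * n" "z \<noteq> T" "p z = T"
    using matchingD[OF p(1), of T] T unfolding z_def by auto
  have zm: "z \<noteq> m" "z \<noteq> m - 1" using z(4) pm m T by auto
  have mT: "m < T" and m1: "1 \<le> m - 1" "m - 1 \<le> 2 * n" using m T by simp_all
  have v: "p' m = T" "p' T = m" "p' (m - 1) = z" "p' z = m - 1"
    unfolding p'_def z_def[symmetric] using z zm mT m by simp_all
  have po: "p' j = p j" if "j \<notin> {m - 1, m, T, z}" for j
    unfolding p'_def z_def[symmetric] using that by simp
  have inner: "p j = 2 * n + 1 - j" if "m < j" "j < T" for j
  proof (cases "j \<le> n")
    case False
    then have "p (2 * n + 1 - j) = j" using vert[of "2 * n + 1 - j"] that unfolding T_def by auto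
    then show ?thesis using matchingD(4)[OF p(1), of "2 * n + 1 - j"] that False unfolding T_def by auto
  qed (use vert that in auto)
  have inner': "m < p j \<and> p j < T" if "m < j" "j < T" for j
    using inner[OF that] that m unfolding T_def by auto
  have inner2: "m < j \<and> j < T" if "m < p j" "p j < T" "1 \<le> j" "j \<le> 2 * n" for j
    using inner'[OF that(1,2)] matchingD(4)[OF p(1) that(3,4)] by simp
  have zout: "\<not> (m < z \<and> z < T)" using inner'[of z] z by auto
  have out: "p j \<notin> {m - 1, m, T, z}" if "1 \<le> j" "j \<le> 2 * n" "j \<notin> {m - 1, m, T, z}" for j
  proof
    assume "p j \<in> {m - 1, m, T, z}"
    then have "p (p j) \<in> {m, m - 1, z, T}" using pm m(3) z(4) z_def by auto
    then show False using matchingD(4)[OF p(1) that(1,2)] that(3) by auto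
  qed
  show "matching n p'"
    unfolding matching_def
  proof
    fix j assume j: "j \<in> {1..2 * n}"
    show "p' j \<in> {1..2 * n} \<and> p' j \<noteq> j \<and> p' (p' j) = j"
    proof (cases "j \<in> {m - 1, m, T, z}")
      case True
      then show ?thesis by (elim insertE emptyE) (use z zm m m1 mT T v in simp_all)
    next
      case False
      have "p' j = p j" "p' (p j) = p (p j)" using out[of j] j False by (auto intro!: po)
      then show ?thesis using matchingD[OF p(1), of j] j by auto
    qed
  qed
  show "p' j = 2 * n + 1 - j" if "m \<le> j" "j \<le> n" for j
  proof (cases "j = m")
    case False
    then have "j \<notin> {m - 1, m, T, z}" using that T zout by auto
    then show ?thesis using vert[of j] that False po by simp
  qed (use v(1) T_def in simp)
  show "p' (m - 1) \<noteq> m" using zm v(3) by simp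
  show "surgery (m - 1) p' j = p j" if "1 \<le> j" "j \<le> 2 * n" for j
  proof -
    have "surgery (m - 1) p' = p'(z := T, T := z, m - 1 := m, m := m - 1)"
      using v zm m(1) by (simp add: surgery_def)
    then show ?thesis
      using z zm m mT pm z_def po[of j] by (cases "j \<in> {m - 1, m, T, z}") auto
  qed
  show "noncrossing n p'"
    unfolding noncrossing_def
  proof (intro ballI notI)
    fix x y assume x: "x \<in> {1..2 * n}" and y: "y \<in> {1..2 * n}" and c: "x < y \<and> y < p' x \<and> p' x < p' y"
    have nc: False if "u < v" "v < p u" "p u < p v" "1 \<le> u" "v \<le> 2 * n" for u v
      using noncrossingD[OF p(2) that(4,1,2,3,5)] .
    have outer: "p j < m \<or> T < p j" if "1 \<le> j" "j \<le> 2 * n" "j \<notin> {m - 1, m, T, z}" "j < m \<or> T < j" for j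
      using out[OF that(1-3)] inner2[OF _ _ that(1,2)] that(4) by (metis insertCI linorder_neqE_nat not_less_iff_gr_or_eq)
    show False
    proof (cases "x \<in> {m - 1, m, T, z}")
      case True
      then consider "x = m" | "x = T" | "x = m - 1" | "x = z" "x \<noteq> T" by blast
      then show False
      proof cases
        case 1
        then have c': "m < y" "y < T" "T < p' y" using c v(1) by simp_all
        then have "y \<notin> {m - 1, m, T, z}" using zout by auto
        then show False using inner'[of y] c' po by simp
      next
        case 2
        then show False using c v(2) mT by simp
      next
        case 3
        then have c': "m - 1 < y" "y < z" "z < p' y" using c v(3) by simp_all
        then have "T < z" using zout zm z(3) by auto
        then have "y \<noteq> m" "y \<noteq> T" using c' mT v(1,2) by auto
        then have yn: "y \<notin> {m - 1, m, T, z}" using c' by auto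
        then have py: "p' y = p y" by (rule po)
        have "T < y"
        proof (rule ccontr)
          assume "\<not> T < y"
          then have "m < y" "y < T" using yn c' by auto
          then show False using inner'[of y] py c' \<open>T < z\<close> by auto
        qed
        then show False using nc[of T y] c' py y T z_def by auto
      next
        case 4
        then have c': "z < y" "y < m - 1" "m - 1 < p' y" using c v(4) by simp_all
        have yn: "y \<notin> {m - 1, m, T, z}" using c' mT by auto
        then have py: "p' y = p y" by (rule po)
        have ym: "y < m" using c'(2) by arith
        then have "p y < m \<or> T < p y" using outer[of y] yn y by simp
        moreover have "p y \<noteq> m" using out[of y] yn y by simp
        ultimately have "T < p y" using c'(3) py by arith
        moreover have "y < T" using ym mT by simp
        ultimately show False using nc[of z y] c'(1) z(1,4) y by simp
      qed
    next
      case xn: False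
      then have px: "p' x = p x" by (rule po)
      show False
      proof (cases "y \<in> {m - 1, m, T, z}")
        case True
        then consider "y = m" | "y = T" | "y = m - 1" | "y = z" "y \<noteq> T" by blast
        then show False
        proof cases
          case 1
          then have "m < p x" "p x < T" "x < m" using c px v(1) by simp_all
          then show False using inner2[of x] x by auto
        next
          case 2
          then show False using c v(2) mT by simp
        next
          case 3
          then have c': "x < m - 1" "m - 1 < p x" "p x < z" using c px v(3) by simp_all
          have xm: "x < m" using c'(1) by arith
          then have "p x < m \<or> T < p x" using outer[of x] xn x by simp
          moreover have "p x \<noteq> m" using out[of x] xn x by simp
          ultimately have "T < p x" using c'(2) by arith
          moreover have "x < T" using xm mT by simp
          ultimately show False using nc[of x T] c'(3) x T z_def by simp
        next
          case 4
          then have pm1: "p x < m - 1" and xz: "x < z" "z < p x" using c px v(4) by simp_all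
          have "p x < T" using pm1 mT by arith
          then show False using nc[of x z] xz x z by simp
        qed
      next
        case False
        then have "p' y = p y" by (rule po)
        then show False using nc[of x y] c px x y by auto
      qed
    qed
  qed
qed

text \<open>
  A cap whose ends are not neighbours encloses the partner of its first inner point, and so a shorter
  cap.
\<close>

lemma adjacent_cap:
  assumes p: "matching n p" "noncrossing n p" and j: "1 \<le> j" "j < p j" "p j \<le> m" "m \<le> 2 * n"
  shows "\<exists>i. 1 \<le> i \<and> p i = i + 1 \<and> i + 1 \<le> m"
  using j(1-3)
proof (induction "p j - j" arbitrary: j rule: less_induct)
  case less
  show ?case
  proof (cases "p j = j + 1")
    case False
    let ?y = "j + 1"
    have y: "1 \<le> ?y" "?y < p j" "?y \<le> 2 * n" using less.prems False j(4) by auto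
    note my = matchingD[OF p(1) y(1,3)]
    have mj: "p (p j) = j" using matchingD[OF p(1), of j] less.prems j(4) by auto
    have "\<not> p j < p ?y" using noncrossingD[OF p(2), of j ?y] less.prems y by auto
    moreover have "p ?y \<noteq> p j" using my(4) mj by auto
    moreover have "\<not> p ?y < j"
    proof
      assume "p ?y < j"
      then show False using noncrossingD[OF p(2), of "p ?y" j] my less.prems y j(4) by auto
    qed
    moreover have "p ?y \<noteq> j" using my(4) y(2) by auto
    ultimately have "?y < p ?y" "p ?y < p j" using my(3) by auto
    then show ?thesis using less.hyps[of ?y] less.prems y by auto
  qed (use less.prems in auto)
qed

text \<open>
  The \<open>n\<close> bottom points are mapped to the \<open>n\<close> top points, and absence of crossings makes this map
  strictly decreasing in the numbering. There is only one such map.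
\<close>

lemma no_caps_imp_vertical:
  assumes p: "matching n p" "noncrossing n p" and nocap: "\<And>j. 1 \<le> j \<Longrightarrow> j \<le> n \<Longrightarrow> n < p j"
  shows "1 \<le> j \<Longrightarrow> j \<le> 2 * n \<Longrightarrow> p j = 2 * n + 1 - j"
proof -
  have dec: "p y < p x" if "1 \<le> x" "x < y" "y \<le> n" for x y
  proof (rule ccontr)
    assume "\<not> ?thesis"
    moreover have "p x \<noteq> p y" using matchingD(4)[OF p(1), of x] matchingD(4)[OF p(1), of y] that by auto
    ultimately show False using noncrossingD[OF p(2), of x y] nocap[of x] that by auto
  qed
  \<comment> \<open>A strictly decreasing map is bounded from above by counting down from \<open>2 * n\<close> at the left
    end, and from below by counting up from \<open>n + 1\<close> at the right end.\<close>
  have up: "Suc d \<le> n \<Longrightarrow> p (Suc d) + Suc d \<le> 2 * n + 1" for d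
  proof (induction d)
    case 0
    then show ?case using matchingD(2)[OF p(1), of 1] by simp
  next
    case (Suc d)
    then show ?case using dec[of "Suc d" "Suc (Suc d)"] by simp
  qed
  have down: "d < n \<Longrightarrow> n + 1 + d \<le> p (n - d)" for d
  proof (induction d)
    case 0
    then show ?case using nocap[of n] by simp
  next
    case (Suc d)
    have "p (n - d) < p (n - Suc d)" by (rule dec) (use Suc.prems in arith)+
    then show ?case using Suc by simp
  qed
  have low: "p j = 2 * n + 1 - j" if "1 \<le> j" "j \<le> n" for j
    using up[of "j - 1"] down[of "n - j"] that by simp
  show "p j = 2 * n + 1 - j" if j: "1 \<le> j" "j \<le> 2 * n"
  proof (cases "j \<le> n")
    case False
    then have "p (2 * n + 1 - j) = j" using low[of "2 * n + 1 - j"] j by auto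
    then show ?thesis using matchingD(4)[OF p(1), of "2 * n + 1 - j"] j False by auto
  qed (use low j in simp)
qed

text \<open>
  Outer induction on the number \<open>m\<close> of strands that may fail to be vertical, inner induction on the
  distance of the cap from its goal at \<open>m - 1\<close>, \<open>m\<close>.
\<close>

theorem noncrossing_matching_generable:
  assumes "matching n p" "noncrossing n p"
  shows "generable n p"
proof -
  have "generable n p"
    if "m \<le> n" "matching n p" "noncrossing n p" "\<And>j. m < j \<Longrightarrow> j \<le> n \<Longrightarrow> p j = 2 * n + 1 - j" for m p
    using that
  proof (induction m arbitrary: p rule: less_induct)
    case (less m)
    have cap: "generable n p"
      if "1 \<le> i" "p i = i + 1" "i + 1 \<le> m" "matching n p" "noncrossing n p"
        "\<And>j. m < j \<Longrightarrow> j \<le> n \<Longrightarrow> p j = 2 * n + 1 - j" for i p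
      using that
    proof (induction "m - i" arbitrary: i p rule: less_induct)
      case less': less
      note prems = less'.prems
      show ?case
      proof (cases "i + 1 = m")
        case True
        have m2: "2 \<le> m" "p (m - 1) = m" using True prems(1,2) by auto
        note s = straighten_strand[OF prems(4,5) m2(1) less.prems(1) m2(2) prems(6)]
        let ?p' = "p(m := 2 * n + 1 - m, 2 * n + 1 - m := m, m - 1 := p (2 * n + 1 - m), p (2 * n + 1 - m) := m - 1)"
        have g: "generable n ?p'"
          using less.prems(1) m2(1) by (intro less.IH[of "m - 1"] s) auto
        have "generable n (surgery (m - 1) ?p')"
          by (rule generable_surgery[OF g]) (use m2(1) less.prems(1) s(4) in auto)
        then show ?thesis by (rule generable_cong) (use s(5) in auto)
      next
        case False
        then have i2: "i + 2 \<le> m" "i + 2 \<le> n" using prems(3) less.prems(1) by auto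
        note s = move_cap[OF prems(4,5,1) i2(2) prems(2)]
        let ?p' = "surgery (i + 1) p"
        have vert: "?p' j = 2 * n + 1 - j" if "m < j" "j \<le> n" for j
        proof -
          have "p (p (i + 2)) = i + 2" using matchingD(4)[OF prems(4), of "i + 2"] i2 by simp
          then have "j \<noteq> p (i + 2)" using prems(6)[OF that] i2 that by auto
          then show ?thesis using s(5)[of j] prems(6)[OF that] i2 that by auto
        qed
        have g: "generable n ?p'"
        proof (rule less'.hyps[of "i + 1"])
          show "m - (i + 1) < m - i" using i2 by simp
        qed (use s(1-3) vert i2 in auto)
        have "p (i + 2) \<noteq> i + 1"
        proof
          assume "p (i + 2) = i + 1"
          then have "p (i + 1) = i + 2" using matchingD(4)[OF prems(4), of "i + 2"] i2 by simp
          moreover have "p (i + 1) = i" using matchingD(4)[OF prems(4), of i] i2 prems(1,2) by simp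
          ultimately show False by simp
        qed
        then have "generable n (surgery i ?p')"
          by (intro generable_surgery[OF g]) (use s(4) prems(1) i2 in auto)
        then show ?thesis by (rule generable_cong) (use s(6) in auto)
      qed
    qed
    show ?case
    proof (cases "\<exists>j. 1 \<le> j \<and> j < p j \<and> p j \<le> n")
      case True
      then obtain j where j: "1 \<le> j" "j < p j" "p j \<le> n" by blast
      have "p j \<le> m"
      proof (rule ccontr)
        assume "\<not> p j \<le> m"
        then have "p (p j) = 2 * n + 1 - p j" using less.prems(4)[of "p j"] j by simp
        moreover have "p (p j) = j" using matchingD(4)[OF less.prems(2), of j] j by simp
        ultimately show False using j by simp
      qed
      moreover have "m \<le> 2 * n" using less.prems(1) by simp
      ultimately obtain i where "1 \<le> i" "p i = i + 1" "i + 1 \<le> m"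
        using adjacent_cap[OF less.prems(2,3) j(1,2)] by blast
      then show ?thesis using less.prems(2-4) by (rule cap)
    next
      case False
      have "n < p j" if j: "1 \<le> j" "j \<le> n" for j
      proof (rule ccontr)
        assume a: "\<not> n < p j"
        have m: "1 \<le> p j" "p j \<noteq> j" "p (p j) = j" using matchingD[OF less.prems(2), of j] j by auto
        have "\<not> j < p j" using False a j by auto
        moreover have "\<not> p j < j"
        proof
          assume "p j < j"
          then have "1 \<le> p j \<and> p j < p (p j) \<and> p (p j) \<le> n" using m j by simp
          then show False using False by blast
        qed
        ultimately show False using m(2) by simp
      qed
      then show ?thesis using no_caps_imp_vertical[OF less.prems(2,3)] by (intro generable_vertical) auto
    qed
  qed
  from this[of n p] show ?thesis using assms by simp
qed

theorem lemma2:
  fixes n :: nat and a :: real and D :: "(real \<times> real) set"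
  assumes "n \<ge> 2" and "n_diagram n a D"
  shows "\<exists>b E. generated n b E \<and> n_diagram n b E \<and> diagram_equiv n a D b E"
proof -
  obtain p k where D: "realizes n a D p k" using n_diagram_imp_realizes[OF assms(2)] .
  have "generable n p"
    using noncrossing_matching_generable realizes_imp_matching[OF D] realizes_imp_noncrossing[OF D] .
  then obtain b E where E: "generated n b E" "realizes n b E p k"
    using add_circles unfolding generable_def by metis
  then show ?thesis using realizes_imp_n_diagram realizes_imp_diagram_equiv[OF D] by blast
qed

end
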